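(* Let $L_{DISJ}\subseteq\{0,1,\#\}^*$ be the language $$L_{DISJ}=\bigl\{\,1^k\#(\mathbf{x}\#\mathbf{y}\#\mathbf{x}\#)^{2^k}\ \big|\ k\ge 1,\ \mathbf{x},\mathbf{y}\in\{0,1\}^{2^{2k}},\ DISJ_{2^{2k}}(\mathbf{x},\mathbf{y})=1\,\bigr\}.$$ There exists a constant $c_1>0$ such that $L_{DISJ}\notin OBPSPACE(c_1n^{1/3})$.
   Context: **Disjointness.** For $m\ge1$ and $\mathbf{x}=x_0\cdots x_{m-1}$, $\mathbf{y}=y_0\cdots y_{m-1}$ in $\{0,1\}^m$, $DISJ_m(\mathbf{x},\mathbf{y})=\bigwedge_{i=0}^{m-1}((\neg x_i)\vee(\neg y_i))$; i.e. $DISJ_m(\mathbf{x},\mathbf{y})=1$ iff there is no index $i$ with $x_i=y_i=1$. The expression $(u)^{2^k}$ denotes the concatenation of $2^k$ copies of the string $u$. **Online probabilistic Turing machine (OPTM).** A probabilistic (coin-flipping) Turing machine with two tapes, an input tape and a read-write work tape, both over the alphabet $\Sigma=\{0,1,\#\}$, whose input tape is read-only and one-way: the input head can move right but never left. The acceptance probability $p_M(w)$ of an OPTM $M$ on input $w$ is the probability, over all coin flips, that $M$ halts in an accepting state. The machine is not required to halt: rejecting means either halting in a non-accepting state or never halting. The space used on input $w$ is the number of work-tape cells used on the worst coin flips. **The class $OBPSPACE(s)$.** A language $L\subseteq\Sigma^*$ is in $OBPSPACE(s)$ if there is an OPTM $M$ such that for each $w\in\Sigma^*$: (i) if $w\in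 L$ then $p_M(w)\ge 2/3$; (ii) if $w\notin L$ then $p_M(w)<1/3$; (iii) $M$ uses at most $s(|w|)$ space on the worst coin flips. In the notation $OBPSPACE(s(n))$, $n$ is the input length. Convention: a real-valued bound $s(n)$ is read as the integer $\max\{1,\lceil s(n)\rceil\}$. *)

theory Defs
  imports "HOL-Probability.Probability"
begin

section \<open>Online probabilistic Turing machines\<close>

datatype symbol = Zero | One | Hash

datatype move = MoveLeft | Stay | MoveRight

text \<open>
  A tape cell holds a \<open>symbol option\<close>, where \<open>None\<close> is the blank. The transition function
  receives the current state, the scanned input cell, the scanned work cell and the outcome of one
  fair coin flip (which it may ignore); it returns the new state, the new contents of the work cell,
  whether the input head advances one cell to the right (it can only stay otherwise), and
  the move of the work head.
\<close>

record optm =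
  states :: "nat set"
  start :: nat
  halting :: "nat set"
  accepting :: "nat set"
  delta :: "nat \<Rightarrow> symbol option \<Rightarrow> symbol option \<Rightarrow> bool \<Rightarrow> nat \<times> symbol option \<times> bool \<times> move"

definition is_optm :: "optm \<Rightarrow> bool" where
  "is_optm M \<longleftrightarrow>
     finite (states M) \<and> start M \<in> states M \<and>
     accepting M \<subseteq> halting M \<and> halting M \<subseteq> states M \<and>
     (\<forall>q\<in>states M. \<forall>a b c. fst (delta M q a b c) \<in> states M)"

text \<open>The work tape is infinite in both directions.\<close>

record config =
  state :: nat
  in_pos :: nat
  work_pos :: int
  work_tape :: "int \<Rightarrow> symbol option"

fun move_head :: "move \<Rightarrow> int \<Rightarrow> int" where
  "move_head MoveLeft p = p - 1"
| "move_head Stay p = p"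
| "move_head MoveRight p = p + 1"

definition input_cell :: "symbol list \<Rightarrow> nat \<Rightarrow> symbol option" where
  "input_cell w i = (if i < length w then Some (w ! i) else None)"

definition init_config :: "optm \<Rightarrow> config" where
  "init_config M = \<lparr>state = start M, in_pos = 0, work_pos = 0, work_tape = (\<lambda>_. None)\<rparr>"

definition step :: "optm \<Rightarrow> symbol list \<Rightarrow> bool \<Rightarrow> config \<Rightarrow> config" where
  "step M w coin C =
     (if state C \<in> halting M then C
      else let (q, b, adv, mv) =
                 delta M (state C) (input_cell w (in_pos C)) (work_tape C (work_pos C)) coin
           in \<lparr>state = q,
               in_pos = (if adv then Suc (in_pos C) else in_pos C),
               work_pos = move_head mv (work_pos C),
               work_tape = (work_tape C)(work_pos C := b)\<rparr>)"

fun run :: "optm \<Rightarrow> symbol list \<Rightarrow> (nat \<Rightarrow> bool) \<Rightarrow> nat \<Rightarrow> config" where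
  "run M w \<omega> 0 = init_config M"
| "run M w \<omega> (Suc t) = step M w (\<omega> t) (run M w \<omega> t)"

definition coin_space :: "(nat \<Rightarrow> bool) measure" where
  "coin_space = (\<Pi>\<^sub>M t\<in>UNIV. measure_pmf (bernoulli_pmf (1/2)))"

definition halts_accepting :: "optm \<Rightarrow> symbol list \<Rightarrow> (nat \<Rightarrow> bool) \<Rightarrow> bool" where
  "halts_accepting M w \<omega> \<longleftrightarrow> (\<exists>t. state (run M w \<omega> t) \<in> accepting M)"

definition accept_prob :: "optm \<Rightarrow> symbol list \<Rightarrow> real" where
  "accept_prob M w = measure coin_space {\<omega> \<in> space coin_space. halts_accepting M w \<omega>}"

text \<open>A work cell counts as used once the work head has scanned it (this includes the initial
  cell); the value is \<open>\<infinity>\<close> if the number of used cells is unbounded.\<close>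

definition space_used :: "optm \<Rightarrow> symbol list \<Rightarrow> enat" where
  "space_used M w = (SUP \<omega>. SUP t. enat (card ((\<lambda>i. work_pos (run M w \<omega> i)) ` {..t})))"

definition space_bound :: "real \<Rightarrow> nat" where
  "space_bound r = nat (max 1 \<lceil>r\<rceil>)"

definition OBPSPACE :: "(nat \<Rightarrow> real) \<Rightarrow> symbol list set set" where
  "OBPSPACE s = {L. \<exists>M. is_optm M \<and>
     (\<forall>w. (w \<in> L \<longrightarrow> accept_prob M w \<ge> 2/3) \<and>
          (w \<notin> L \<longrightarrow> accept_prob M w < 1/3) \<and>
          space_used M w \<le> enat (space_bound (s (length w))))}"

text \<open>The event whose probability is \<open>accept_prob\<close> is measurable, as it is a countable
  union of events depending on finitely many coin flips; so \<open>measure\<close> does not fall back to its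
  default value \<open>0\<close> in \<open>accept_prob\<close>.\<close>

lemma sets_run: "{\<omega> \<in> space coin_space. P (run M w \<omega> t)} \<in> sets coin_space"
proof (induction t arbitrary: P)
  case 0
  show ?case by (cases "P (init_config M)") auto
next
  case (Suc t)
  have coin: "{\<omega> \<in> space coin_space. Q (\<omega> t)} \<in> sets coin_space" for Q :: "bool \<Rightarrow> bool"
  proof -
    have "(\<lambda>\<omega>. \<omega> t) \<in> measurable coin_space (count_space UNIV)"
      unfolding coin_space_def
      by (rule measurable_compose[OF measurable_component_singleton]) auto
    then have "(\<lambda>\<omega>. \<omega> t) -` Collect Q \<inter> space coin_space \<in> sets coin_space"
      by (rule measurable_sets) auto
    moreover have "(\<lambda>\<omega>. \<omega> t) -` Collect Q \<inter> space coin_space = {\<omega> \<in> space coin_space. Q (\<omega> t)}"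
      by auto
    ultimately show ?thesis by simp
  qed
  have "{\<omega> \<in> space coin_space. P (run M w \<omega> (Suc t))} =
    ({\<omega> \<in> space coin_space. \<omega> t} \<inter> {\<omega> \<in> space coin_space. P (step M w True (run M w \<omega> t))}) \<union>
    ({\<omega> \<in> space coin_space. \<not> \<omega> t} \<inter> {\<omega> \<in> space coin_space. P (step M w False (run M w \<omega> t))})"
    (is "?A = ?B")
  proof (rule set_eqI)
    fix \<omega>
    show "\<omega> \<in> ?A \<longleftrightarrow> \<omega> \<in> ?B" by (cases "\<omega> t") auto
  qed
  then show ?case
    using coin[of "\<lambda>b. b"] coin[of Not] Suc.IH by auto
qed

lemma sets_halts_accepting:
  "{\<omega> \<in> space coin_space. halts_accepting M w \<omega>} \<in> sets coin_space"
proof -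
  have "{\<omega> \<in> space coin_space. halts_accepting M w \<omega>} =
      (\<Union>t. {\<omega> \<in> space coin_space. state (run M w \<omega> t) \<in> accepting M})"
    by (auto simp: halts_accepting_def)
  also have "\<dots> \<in> sets coin_space"
    using sets_run[of "\<lambda>C. state C \<in> accepting M" M w] by (intro sets.countable_UN) auto
  finally show ?thesis .
qed

lemma prob_space_coin_space: "prob_space coin_space"
  unfolding coin_space_def by (intro prob_space_PiM prob_space_measure_pmf)


section \<open>The language of repeated disjointness instances\<close>

definition DISJ :: "nat \<Rightarrow> bool list \<Rightarrow> bool list \<Rightarrow> bool" where
  "DISJ m x y \<longleftrightarrow> (\<forall>i<m. \<not> x ! i \<or> \<not> y ! i)"

definition bits :: "bool list \<Rightarrow> symbol list" where
  "bits x = map (\<lambda>b. if b then One else Zero) x"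

definition L_DISJ :: "symbol list set" where
  "L_DISJ =
     {replicate k One @ [Hash] @
        concat (replicate (2 ^ k) (bits x @ [Hash] @ bits y @ [Hash] @ bits x @ [Hash]))
      | k x y. k \<ge> 1 \<and> length x = 2 ^ (2 * k) \<and> length y = 2 ^ (2 * k) \<and> DISJ (2 ^ (2 * k)) x y}"

end

theory Submission
  imports Defs
begin

text \<open>
  Cut the input word into its blocks, each of which depends on \<open>x\<close> only or on \<open>y\<close> only. Summing over
  the configurations in which the input head crosses the block boundaries writes the acceptance
  probability as a sum of products \<open>f x * g y\<close>; with space \<open>s\<close> and \<open>O(2^k)\<close> blocks there are only
  \<open>2^O(s * 2^k)\<close> of them. On the other hand, Razborov's corruption argument shows that separating
  disjoint from intersecting sets in this way takes \<open>2^\<Omega>(2^(2 * k))\<close> terms. The hard distribution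
  used here is of product type: a uniformly random \<open>D\<close> and uniformly random subsets \<open>X\<close> of \<open>D\<close> and
  \<open>Y\<close> of its complement; for intersecting pairs a random common element is added to both. If \<open>f\<close> has
  non-negligible mass on the subsets of \<open>D\<close>, then few elements of \<open>D\<close> are biased under \<open>f\<close>, and
  adding an unbiased element changes the mass by a bounded factor only.
\<close>

section \<open>Corruption bound for disjointness\<close>

definition subset_avg :: "'a set \<Rightarrow> ('a set \<Rightarrow> real) \<Rightarrow> real" where
  "subset_avg D f = (\<Sum>X\<in>Pow D. f X) / 2 ^ card D"

lemma subset_avg_insert:
  assumes "finite D" "i \<notin> D"
  shows "subset_avg (insert i D) f = (subset_avg D f + subset_avg D (\<lambda>X. f (insert i X))) / 2"
proof -
  have inj: "inj_on (insert i) (Pow D)"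
    using assms by (auto simp: inj_on_def)
  have "(\<Sum>X\<in>Pow (insert i D). f X) = (\<Sum>X\<in>Pow D. f X) + (\<Sum>X\<in>insert i ` Pow D. f X)"
    unfolding Pow_insert using assms by (intro sum.union_disjoint) auto
  also have "(\<Sum>X\<in>insert i ` Pow D. f X) = (\<Sum>X\<in>Pow D. f (insert i X))"
    using sum.reindex[OF inj, of f] by simp
  finally show ?thesis
    using assms by (simp add: subset_avg_def field_simps)
qed

lemma subset_avg_remove:
  assumes "finite D" "i \<in> D"
  shows "subset_avg D f = (subset_avg (D - {i}) f + subset_avg (D - {i}) (\<lambda>X. f (insert i X))) / 2"
  using subset_avg_insert[of "D - {i}" i f] assms by (simp add: insert_absorb)

lemma subset_avg_mono:
  assumes "\<And>X. X \<subseteq> D \<Longrightarrow> f X \<le> g X"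
  shows "subset_avg D f \<le> subset_avg D g"
  unfolding subset_avg_def using assms by (intro divide_right_mono sum_mono) auto

lemma subset_avg_cong:
  assumes "\<And>X. X \<subseteq> D \<Longrightarrow> f X = g X"
  shows "subset_avg D f = subset_avg D g"
  unfolding subset_avg_def using assms by (intro arg_cong2[where f = "(/)"] sum.cong) auto

lemma subset_avg_add: "subset_avg D (\<lambda>X. f X + g X) = subset_avg D f + subset_avg D g"
  by (simp add: subset_avg_def sum.distrib add_divide_distrib)

lemma subset_avg_cmult: "subset_avg D (\<lambda>X. c * f X) = c * subset_avg D f"
  by (simp add: subset_avg_def sum_distrib_left)

lemma subset_avg_multc: "subset_avg D (\<lambda>X. f X * c) = subset_avg D f * c"
  by (simp add: subset_avg_def sum_distrib_right)

lemma subset_avg_sum: "subset_avg D (\<lambda>X. \<Sum>i\<in>I. f i X) = (\<Sum>i\<in>I. subset_avg D (f i))"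
  unfolding subset_avg_def sum_divide_distrib by (rule sum.swap)

lemma subset_avg_const: "finite D \<Longrightarrow> subset_avg D (\<lambda>X. c) = c"
  by (simp add: subset_avg_def card_Pow)

lemma subset_avg_nonneg: "(\<And>X. X \<subseteq> D \<Longrightarrow> 0 \<le> f X) \<Longrightarrow> 0 \<le> subset_avg D f"
  unfolding subset_avg_def by (intro divide_nonneg_nonneg sum_nonneg) auto

lemma subset_avg_le_const:
  "finite D \<Longrightarrow> (\<And>X. X \<subseteq> D \<Longrightarrow> f X \<le> c) \<Longrightarrow> subset_avg D f \<le> c"
  using subset_avg_mono[of D f "\<lambda>_. c"] by (simp add: subset_avg_const)

lemma subset_avg_ge_const:
  "finite D \<Longrightarrow> (\<And>X. X \<subseteq> D \<Longrightarrow> c \<le> f X) \<Longrightarrow> c \<le> subset_avg D f"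
  using subset_avg_mono[of D "\<lambda>_. c" f] by (simp add: subset_avg_const)

text \<open>Membership of distinct elements in a uniformly random subset is decided by independent
  fair bits, so the expectation factors.\<close>

lemma subset_avg_prod:
  assumes "finite D"
  shows "subset_avg D (\<lambda>X. \<Prod>j\<in>D. h j (j \<in> X)) = (\<Prod>j\<in>D. (h j True + h j False) / 2)"
  using assms
proof (induction D)
  case empty
  show ?case by (simp add: subset_avg_def)
next
  case (insert i D)
  have "subset_avg D (\<lambda>X. \<Prod>j\<in>insert i D. h j (j \<in> X))
      = subset_avg D (\<lambda>X. h i False * (\<Prod>j\<in>D. h j (j \<in> X)))"
  proof (intro subset_avg_cong)
    fix X assume "X \<subseteq> D"
    then have "i \<notin> X" using insert by auto
    then show "(\<Prod>j\<in>insert i D. h j (j \<in> X)) = h i False * (\<Prod>j\<in>D. h j (j \<in> X))"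
      using insert by simp
  qed
  moreover have "subset_avg D (\<lambda>X. \<Prod>j\<in>insert i D. h j (j \<in> insert i X))
      = subset_avg D (\<lambda>X. h i True * (\<Prod>j\<in>D. h j (j \<in> X)))"
  proof (intro subset_avg_cong)
    fix X assume "X \<subseteq> D"
    have "(\<Prod>j\<in>D. h j (j \<in> insert i X)) = (\<Prod>j\<in>D. h j (j \<in> X))"
    proof (intro prod.cong refl)
      fix j assume "j \<in> D"
      then have "(j \<in> insert i X) = (j \<in> X)" using insert by auto
      then show "h j (j \<in> insert i X) = h j (j \<in> X)" by simp
    qed
    then show "(\<Prod>j\<in>insert i D. h j (j \<in> insert i X)) = h i True * (\<Prod>j\<in>D. h j (j \<in> X))"
      using insert by simp
  qed
  ultimately show ?case
    using insert by (simp add: subset_avg_insert subset_avg_cmult field_simps)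
qed

text \<open>If a nonnegative \<open>f\<close> is read as an unnormalised density on the subsets of
  \<open>D\<close>, this says that one of the events \<open>i \<in> X\<close> and
  \<open>i \<notin> X\<close> has probability above 3/4.\<close>

definition biased :: "'a \<Rightarrow> 'a set \<Rightarrow> ('a set \<Rightarrow> real) \<Rightarrow> bool" where
  "biased i D f \<longleftrightarrow>
     3 * subset_avg (D - {i}) (\<lambda>X. f (insert i X)) < subset_avg (D - {i}) f \<or>
     3 * subset_avg (D - {i}) f < subset_avg (D - {i}) (\<lambda>X. f (insert i X))"

text \<open>Exponential moments replace entropy here: under the density \<open>f\<close>, the number of biased
  coordinates at which \<open>X\<close> takes the heavier value has mean at least three quarters of their
  total number, and this is exponentially unlikely under the uniform distribution.\<close>

lemma subset_avg_le_biased: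
  fixes f :: "'a set \<Rightarrow> real"
  assumes fin: "finite D" and f: "\<And>X. 0 \<le> f X" "\<And>X. f X \<le> 1"
  shows "subset_avg D f \<le> (2 * 3 powr (-3/4)) ^ card {i \<in> D. biased i D f}"
proof -
  define J where "J = {i \<in> D. biased i D f}"
  \<comment> \<open>For a biased \<open>j\<close>, \<open>s j\<close> is the heavier value of its
    membership bit. Centring \<open>d j\<close> at 3/4 makes its mean under the density
    \<open>f\<close> nonnegative, which is the fact \<open>pos\<close>.\<close>
  define s where "s j \<longleftrightarrow> 3 * subset_avg (D - {j}) f < subset_avg (D - {j}) (\<lambda>X. f (insert j X))" for j
  define d :: "'a \<Rightarrow> bool \<Rightarrow> real" where "d j b = of_bool (b = s j) - 3/4" for j b
  define S where "S X = (\<Sum>j\<in>J. d j (j \<in> X))" for X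
  \<comment> \<open>The rate \<open>ln 3\<close> minimises
    \<open>(exp (t / 4) + exp (- 3 * t / 4)) / 2\<close> over \<open>t\<close>; the minimum
    \<open>2 * 3 powr (-3/4)\<close> is below 1.\<close>
  define h where "h j b = (if j \<in> J then exp (ln 3 * d j b) else 1)" for j b
  have finJ: "finite J" and JD: "J \<subseteq> D" using fin by (auto simp: J_def)
  have pos: "0 \<le> subset_avg D (\<lambda>X. d j (j \<in> X) * f X)" if "j \<in> J" for j
  proof -
    let ?a0 = "subset_avg (D - {j}) f" and ?a1 = "subset_avg (D - {j}) (\<lambda>X. f (insert j X))"
    have "subset_avg (D - {j}) (\<lambda>X. d j (j \<in> X) * f X) = d j False * ?a0"
      unfolding subset_avg_cmult[symmetric]
      by (rule subset_avg_cong, subst (asm) subset_Diff_insert) simp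
    moreover have "subset_avg (D - {j}) (\<lambda>X. d j (j \<in> insert j X) * f (insert j X)) = d j True * ?a1"
      by (simp add: subset_avg_cmult)
    moreover have "0 \<le> d j False * ?a0 + d j True * ?a1"
      using that by (auto simp: J_def biased_def d_def s_def)
    ultimately show ?thesis
      using that by (subst subset_avg_remove[of _ j]) (use fin JD in auto)
  qed
  have expS: "exp (ln 3 * S X) = (\<Prod>j\<in>D. h j (j \<in> X))" for X
  proof -
    have "exp (ln 3 * S X) = (\<Prod>j\<in>J. exp (ln 3 * d j (j \<in> X)))"
      by (simp add: S_def sum_distrib_left exp_sum finJ)
    also have "\<dots> = (\<Prod>j\<in>J. h j (j \<in> X))"
      by (intro prod.cong) (auto simp: h_def)
    also have "\<dots> = (\<Prod>j\<in>D. h j (j \<in> X))"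
      using fin JD by (intro prod.mono_neutral_left) (auto simp: h_def)
    finally show ?thesis .
  qed
  have e14: "exp (ln 3 * (1/4)) = 3 * (3 powr (-3/4) :: real)"
  proof -
    have "3 * (3 powr (-3/4) :: real) = 3 powr (1 + - 3/4)"
      unfolding powr_add by simp
    then show ?thesis by (simp add: powr_def mult.commute)
  qed
  have e34: "exp (ln 3 * (-3/4)) = (3 powr (-3/4) :: real)"
    by (simp add: powr_def mult.commute)
  have hsum: "(h j True + h j False) / 2 = (if j \<in> J then 2 * 3 powr (-3/4) else 1)" for j
    using e14 e34 by (auto simp: h_def d_def)
  \<comment> \<open>The mean of \<open>S\<close> under \<open>f\<close> is nonnegative, so the added
    term only helps. Then \<open>1 + u \<le> exp u\<close> and \<open>f \<le> 1\<close> remove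
    \<open>f\<close> and leave an exponential moment under the uniform distribution.\<close>
  have "subset_avg D f \<le> subset_avg D (\<lambda>X. f X + ln 3 * (S X * f X))"
  proof -
    have "subset_avg D (\<lambda>X. S X * f X) = (\<Sum>j\<in>J. subset_avg D (\<lambda>X. d j (j \<in> X) * f X))"
      by (simp add: S_def sum_distrib_right subset_avg_sum)
    also have "\<dots> \<ge> 0" using pos by (rule sum_nonneg)
    finally show ?thesis
      by (simp add: subset_avg_add subset_avg_cmult)
  qed
  also have "\<dots> \<le> subset_avg D (\<lambda>X. exp (ln 3 * S X))"
  proof (rule subset_avg_mono)
    fix X
    have "f X + ln 3 * (S X * f X) = (1 + ln 3 * S X) * f X" by (simp add: algebra_simps)
    also have "\<dots> \<le> exp (ln 3 * S X) * f X"
      by (intro mult_right_mono f exp_ge_add_one_self)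
    also have "\<dots> \<le> exp (ln 3 * S X)"
      using f by (simp add: mult_left_le)
    finally show "f X + ln 3 * (S X * f X) \<le> exp (ln 3 * S X)" .
  qed
  also have "\<dots> = (\<Prod>j\<in>D. if j \<in> J then 2 * 3 powr (-3/4) else 1)"
    unfolding expS by (simp only: subset_avg_prod[OF fin] hsum)
  also have "\<dots> = (2 * 3 powr (-3/4)) ^ card J"
    using fin JD by (simp add: prod.If_cases Int_absorb1)
  finally show ?thesis by (simp add: J_def)
qed

text \<open>Either at most \<open>m / 20\<close> elements are biased or the mass of \<open>f\<close>
  is exponentially small; the two summands on the right cover these cases.\<close>

lemma subset_avg_mult_biased_le:
  fixes f :: "'a set \<Rightarrow> real" and m :: nat
  assumes fin: "finite D" and f: "\<And>X. 0 \<le> f X" "\<And>X. f X \<le> 1"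
    and D: "card D \<le> m"
  shows "subset_avg D f * card {i \<in> D. biased i D f} \<le> (subset_avg D f / 20 + 2 powr (- (real m / 160))) * m"
proof -
  define j where "j = card {i \<in> D. biased i D f}"
  have jm: "j \<le> m" unfolding j_def using card_mono[of D "{i \<in> D. biased i D f}"] fin D by auto
  have nn: "0 \<le> subset_avg D f" using f by (intro subset_avg_nonneg) auto
  let ?\<rho> = "2 * 3 powr (-3/4) :: real"
  show ?thesis
  proof (cases "real j \<le> m / 20")
    case True
    then have "subset_avg D f * j \<le> subset_avg D f * (m / 20)"
      using nn by (intro mult_left_mono) auto
    also have "\<dots> \<le> (subset_avg D f / 20 + 2 powr (- (real m / 160))) * m"
      by (simp add: algebra_simps)
    finally show ?thesis by (simp add: j_def)
  next
    case False
    \<comment> \<open>As 256/729 is below 1/2, every eight biased elements halve the bound, and more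
      than \<open>m / 20\<close> of them bring it below \<open>2 powr (- (m / 160))\<close>.\<close>
    have "(3 powr (-3/4) :: real) ^ 8 = 3 powr (-6)"
      by (simp add: powr_power)
    also have "\<dots> = 1 / 729"
      by (simp add: powr_minus powr_numeral divide_simps)
    finally have "?\<rho> ^ 8 \<le> 1 / 2" by (simp add: power_mult_distrib)
    moreover have "?\<rho> ^ 8 = ?\<rho> powr 8"
      by (simp add: powr_numeral)
    ultimately have "ln (?\<rho> powr 8) \<le> ln (1/2)"
      by (subst ln_le_cancel_iff) auto
    then have ln\<rho>: "ln ?\<rho> \<le> - ln 2 / 8"
      by (simp add: ln_powr ln_div del: powr_numeral)
    have "subset_avg D f \<le> ?\<rho> ^ j"
      unfolding j_def by (rule subset_avg_le_biased[OF fin f])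
    also have "\<dots> = exp (j * ln ?\<rho>)"
      by (simp add: exp_of_nat_mult)
    also have "\<dots> \<le> exp (m / 20 * (- ln 2 / 8))"
    proof -
      have "j * ln ?\<rho> \<le> j * (- ln 2 / 8)" using ln\<rho> by (intro mult_left_mono) auto
      also have "\<dots> \<le> m / 20 * (- ln 2 / 8)" using False by (intro mult_right_mono_neg) auto
      finally show ?thesis by simp
    qed
    also have "\<dots> = 2 powr (- (real m / 160))" by (simp add: powr_def)
    finally have "subset_avg D f * j \<le> 2 powr (- (real m / 160)) * m"
      using jm nn by (intro mult_mono) auto
    also have "\<dots> \<le> (subset_avg D f / 20 + 2 powr (- (real m / 160))) * m"
      using nn by (intro mult_right_mono) auto
    finally show ?thesis by (simp add: j_def)
  qed
qed

section \<open>Hard distributions and corruption of a single product\<close>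

definition avg_disj :: "nat \<Rightarrow> (nat set \<Rightarrow> nat set \<Rightarrow> real) \<Rightarrow> real" where
  "avg_disj m P = subset_avg {..<m} (\<lambda>D. subset_avg D (\<lambda>X. subset_avg ({..<m} - D) (\<lambda>Y. P X Y)))"

text \<open>The elements other than \<open>i\<close> are split as in \<open>avg_disj\<close>, so the
  planted \<open>i\<close> is the only common element.\<close>

definition avg_inter :: "nat \<Rightarrow> (nat set \<Rightarrow> nat set \<Rightarrow> real) \<Rightarrow> real" where
  "avg_inter m P = (\<Sum>i<m. subset_avg ({..<m} - {i}) (\<lambda>Z. subset_avg Z (\<lambda>X.
     subset_avg ({..<m} - {i} - Z) (\<lambda>Y. P (insert i X) (insert i Y))))) / m"

text \<open>Here \<open>a0\<close>, \<open>a1\<close> and \<open>b0\<close>, \<open>b1\<close> are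
  averages of two functions without and with a fixed element. If neither function is biased there,
  the four products are comparable, and the left side is at most (18 + 3 + 3) / 4 = 6 times
  \<open>a1 * b1\<close>. Otherwise it is charged to a biased side; the factor 5/2 comes from the
  case where the other side is unbiased.\<close>

lemma unbiased_charge:
  fixes a0 a1 b0 b1 :: real
  assumes nn: "0 \<le> a0" "0 \<le> a1" "0 \<le> b0" "0 \<le> b1"
    and p: "p \<longleftrightarrow> 3 * a1 < a0 \<or> 3 * a0 < a1" and q: "q \<longleftrightarrow> 3 * b1 < b0 \<or> 3 * b0 < b1"
  shows "(a0 * ((b0 + b1) / 2) + (a0 + a1) / 2 * b0) / 2 \<le>
    6 * (a1 * b1) + 5 / 2 * ((a0 + a1) / 2 * b0 * of_bool p + a0 * ((b0 + b1) / 2) * of_bool q)"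
proof -
  define u v x z where "u = a0 * b0" and "v = a0 * b1" and "x = a1 * b0" and "z = a1 * b1"
  have nonneg: "0 \<le> u" "0 \<le> v" "0 \<le> x" "0 \<le> z"
    using nn by (auto simp: u_def v_def x_def z_def)
  have lhs: "(a0 * ((b0 + b1) / 2) + (a0 + a1) / 2 * b0) / 2 = (2 * u + v + x) / 4"
    and rhs: "(a0 + a1) / 2 * b0 = (u + x) / 2" "a0 * ((b0 + b1) / 2) = (u + v) / 2"
    by (simp_all add: u_def v_def x_def field_simps)
  have q': "v \<le> 3 * u" "u \<le> 3 * v" "x \<le> 3 * z" if "\<not> q"
    using that q nn mult_left_mono[of b1 "3 * b0" a0] mult_left_mono[of b0 "3 * b1" a0]
      mult_left_mono[of b0 "3 * b1" a1] by (auto simp: u_def v_def x_def z_def)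
  have p': "x \<le> 3 * u" "v \<le> 3 * z" if "\<not> p"
    using that p nn mult_right_mono[of a1 "3 * a0" b0] mult_right_mono[of a0 "3 * a1" b1]
    by (auto simp: u_def v_def x_def z_def)
  show ?thesis
    unfolding lhs rhs z_def[symmetric] using nonneg p' q' by (cases p; cases q) (simp_all add: field_simps)
qed

text \<open>Planting an unbiased element changes the mass by a bounded factor only, and biased
  elements are few unless the mass is negligible. Averaging over all elements leaves a loss that the
  left side absorbs.\<close>

lemma corruption_rank1:
  fixes f g :: "nat set \<Rightarrow> real"
  assumes m: "m > 0"
    and f: "\<And>X. 0 \<le> f X" "\<And>X. f X \<le> 1" and g: "\<And>X. 0 \<le> g X" "\<And>X. g X \<le> 1"
  shows "avg_disj m (\<lambda>X Y. f X * g Y)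
    \<le> 12 * avg_inter m (\<lambda>X Y. f X * g Y) + 20 * 2 powr (- (real m / 160))"
proof -
  let ?U = "{..<m}" and ?\<theta> = "2 powr (- (real m / 160))"
  define \<Phi> where "\<Phi> D = subset_avg D f * subset_avg (?U - D) g" for D
  define \<Psi> where "\<Psi> i Z = subset_avg Z (\<lambda>X. f (insert i X)) *
    subset_avg (?U - {i} - Z) (\<lambda>Y. g (insert i Y))" for i Z
  define \<beta> :: "nat \<Rightarrow> nat set \<Rightarrow> real" where
    "\<beta> i D = of_bool (i \<in> D \<and> biased i D f) + of_bool (i \<in> ?U - D \<and> biased i (?U - D) g)" for i D
  have L0: "avg_disj m (\<lambda>X Y. f X * g Y) = subset_avg ?U \<Phi>"
    by (simp add: avg_disj_def \<Phi>_def[abs_def] subset_avg_cmult subset_avg_multc)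
  have L1: "avg_inter m (\<lambda>X Y. f X * g Y) = (\<Sum>i<m. subset_avg (?U - {i}) (\<Psi> i)) / m"
    by (simp add: avg_inter_def \<Psi>_def[abs_def] subset_avg_cmult subset_avg_multc)
  have mL1: "m * avg_inter m (\<lambda>X Y. f X * g Y) = (\<Sum>i<m. subset_avg (?U - {i}) (\<Psi> i))"
    using m by (simp add: L1)
  have f0: "0 \<le> subset_avg D f" "0 \<le> subset_avg D (\<lambda>X. f (insert i X))" for D i
    using f by (auto intro: subset_avg_nonneg)
  have g0: "0 \<le> subset_avg D g" "0 \<le> subset_avg D (\<lambda>X. g (insert i X))" for D i
    using g by (auto intro: subset_avg_nonneg)
  have f1: "finite D \<Longrightarrow> subset_avg D f \<le> 1" and g1: "finite D \<Longrightarrow> subset_avg D g \<le> 1" for D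
    using f g by (auto intro: subset_avg_le_const)
  \<comment> \<open>The sets \<open>Z\<close> and \<open>insert i Z\<close> are paired as values of
    \<open>D\<close>: they differ only in the side that may use \<open>i\<close>, which is the
    situation of \<open>unbiased_charge\<close>.\<close>
  have coord: "subset_avg ?U \<Phi> \<le> 6 * subset_avg (?U - {i}) (\<Psi> i) + 5 * subset_avg ?U (\<lambda>D. \<Phi> D * \<beta> i D)"
    if i: "i < m" for i
  proof -
    have pt: "(\<Phi> Z + \<Phi> (insert i Z)) / 2
      \<le> 6 * \<Psi> i Z + 5 / 2 * (\<Phi> Z * \<beta> i Z + \<Phi> (insert i Z) * \<beta> i (insert i Z))"
      if Z: "Z \<subseteq> ?U - {i}" for Z
    proof -
      have finZ: "finite Z" using Z by (rule finite_subset) auto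
      have sets: "?U - insert i Z = ?U - {i} - Z" "?U - Z - {i} = ?U - {i} - Z" "insert i Z - {i} = Z"
        using Z i by auto
      let ?a0 = "subset_avg Z f" and ?a1 = "subset_avg Z (\<lambda>X. f (insert i X))"
      let ?b0 = "subset_avg (?U - {i} - Z) g" and ?b1 = "subset_avg (?U - {i} - Z) (\<lambda>X. g (insert i X))"
      have gZ: "subset_avg (?U - Z) g = (?b0 + ?b1) / 2"
        using subset_avg_remove[of "?U - Z" i g] Z i sets by auto
      have fZ: "subset_avg (insert i Z) f = (?a0 + ?a1) / 2"
        using Z by (intro subset_avg_insert finZ) auto
      have "\<beta> i Z = of_bool (biased i (?U - Z) g)" "\<beta> i (insert i Z) = of_bool (biased i (insert i Z) f)"
        using Z i by (auto simp: \<beta>_def)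
      then show ?thesis
        using unbiased_charge[OF f0(1)[of Z] f0(2)[of Z i] g0(1)[of "?U - {i} - Z"] g0(2)[of "?U - {i} - Z" i],
            of "biased i (insert i Z) f" "biased i (?U - Z) g"]
        unfolding \<Phi>_def \<Psi>_def gZ fZ sets biased_def
        by (simp add: algebra_simps)
    qed
    have "subset_avg ?U \<Phi> = subset_avg (?U - {i}) (\<lambda>Z. (\<Phi> Z + \<Phi> (insert i Z)) / 2)"
      using i subset_avg_remove[of ?U i \<Phi>] subset_avg_multc[of "?U - {i}" "\<lambda>Z. \<Phi> Z + \<Phi> (insert i Z)" "1/2"]
      by (simp add: subset_avg_add)
    also have "\<dots> \<le> subset_avg (?U - {i}) (\<lambda>Z. 6 * \<Psi> i Z
        + 5 / 2 * (\<Phi> Z * \<beta> i Z + \<Phi> (insert i Z) * \<beta> i (insert i Z)))"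
      by (rule subset_avg_mono) (rule pt)
    also have "\<dots> = 6 * subset_avg (?U - {i}) (\<Psi> i) + 5 * subset_avg ?U (\<lambda>D. \<Phi> D * \<beta> i D)"
      using i subset_avg_remove[of ?U i "\<lambda>D. \<Phi> D * \<beta> i D"]
      by (simp only: subset_avg_add subset_avg_cmult finite_lessThan lessThan_iff)
    finally show ?thesis .
  qed
  \<comment> \<open>The biased elements of either side cost at most a twentieth of the mass plus an
    error; in the error terms the average of the other function is bounded by 1.\<close>
  have bad: "(\<Sum>i<m. \<Phi> D * \<beta> i D) \<le> (\<Phi> D / 10 + 2 * ?\<theta>) * m" if D: "D \<subseteq> ?U" for D
  proof -
    have finD: "finite D" using D by (rule finite_subset) auto
    have cD: "card D \<le> m" "card (?U - D) \<le> m"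
      using card_mono[of ?U D] card_mono[of ?U "?U - D"] D by auto
    have F: "subset_avg D f * card {i \<in> D. biased i D f} \<le> (subset_avg D f / 20 + ?\<theta>) * m"
      by (rule subset_avg_mult_biased_le[OF finD f cD(1)])
    have G: "subset_avg (?U - D) g * card {i \<in> ?U - D. biased i (?U - D) g}
        \<le> (subset_avg (?U - D) g / 20 + ?\<theta>) * m"
      by (rule subset_avg_mult_biased_le[OF _ g cD(2)]) auto
    have "(\<Sum>i<m. \<beta> i D) = card {i \<in> D. biased i D f} + card {i \<in> ?U - D. biased i (?U - D) g}"
    proof -
      have "?U \<inter> {i. i \<in> D \<and> biased i D f} = {i \<in> D. biased i D f}"
        "?U \<inter> {i. i \<in> ?U - D \<and> biased i (?U - D) g} = {i \<in> ?U - D. biased i (?U - D) g}"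
        using D by auto
      then show ?thesis
        unfolding \<beta>_def by (simp add: sum.distrib of_bool_def sum.If_cases del: Diff_iff)
    qed
    then have "(\<Sum>i<m. \<Phi> D * \<beta> i D) = subset_avg D f * card {i \<in> D. biased i D f} * subset_avg (?U - D) g
        + subset_avg (?U - D) g * card {i \<in> ?U - D. biased i (?U - D) g} * subset_avg D f"
      by (subst sum_distrib_left[symmetric]) (simp only: \<Phi>_def of_nat_add algebra_simps)
    also have "\<dots> \<le> (subset_avg D f / 20 + ?\<theta>) * m * subset_avg (?U - D) g
        + (subset_avg (?U - D) g / 20 + ?\<theta>) * m * subset_avg D f"
      by (intro add_mono mult_right_mono F G f0 g0)
    also have "\<dots> = (\<Phi> D / 10 + ?\<theta> * subset_avg (?U - D) g + ?\<theta> * subset_avg D f) * m"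
      by (simp add: \<Phi>_def algebra_simps)
    also have "\<dots> \<le> (\<Phi> D / 10 + ?\<theta> * 1 + ?\<theta> * 1) * m"
      using finD by (intro mult_right_mono add_mono mult_left_mono f1 g1) auto
    finally show ?thesis by (simp add: algebra_simps)
  qed
  have "m * subset_avg ?U \<Phi> = (\<Sum>i<m. subset_avg ?U \<Phi>)" by simp
  also have "\<dots> \<le> (\<Sum>i<m. 6 * subset_avg (?U - {i}) (\<Psi> i) + 5 * subset_avg ?U (\<lambda>D. \<Phi> D * \<beta> i D))"
    by (intro sum_mono coord) auto
  also have "\<dots> = 6 * (m * avg_inter m (\<lambda>X Y. f X * g Y)) + 5 * subset_avg ?U (\<lambda>D. \<Sum>i<m. \<Phi> D * \<beta> i D)"
    unfolding subset_avg_sum mL1 by (simp only: sum.distrib sum_distrib_left)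
  also have "subset_avg ?U (\<lambda>D. \<Sum>i<m. \<Phi> D * \<beta> i D) \<le> subset_avg ?U (\<lambda>D. (\<Phi> D / 10 + 2 * ?\<theta>) * m)"
    by (intro subset_avg_mono bad)
  also have "\<dots> = (subset_avg ?U \<Phi> / 10 + 2 * ?\<theta>) * m"
    using subset_avg_multc[of ?U \<Phi> "1/10"] by (simp add: subset_avg_multc subset_avg_add subset_avg_const)
  finally have "m * subset_avg ?U \<Phi> \<le> m * (6 * avg_inter m (\<lambda>X Y. f X * g Y)
      + 5 * (subset_avg ?U \<Phi> / 10 + 2 * ?\<theta>))"
    by (simp add: algebra_simps)
  then have "subset_avg ?U \<Phi> \<le> 6 * avg_inter m (\<lambda>X Y. f X * g Y) + 5 * (subset_avg ?U \<Phi> / 10 + 2 * ?\<theta>)"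
    using m by simp
  \<comment> \<open>The bias term contains 5/10 of the left side; moving it over doubles the
    constants 6 and 10 to 12 and 20.\<close>
  then show ?thesis unfolding L0 by simp
qed

text \<open>A weighted form of a decomposition into \<open>n\<close> rectangles. Factors with values
  in [0,1] let \<open>corruption_rank1\<close> apply to every term with the same error.\<close>

inductive rank1_sum :: "nat \<Rightarrow> ('a \<Rightarrow> 'b \<Rightarrow> real) \<Rightarrow> bool" where
  zero: "rank1_sum 0 (\<lambda>x y. 0)"
| add: "rank1_sum n P \<Longrightarrow> (\<And>x. 0 \<le> f x \<and> f x \<le> 1) \<Longrightarrow> (\<And>y. 0 \<le> g y \<and> g y \<le> 1)
    \<Longrightarrow> rank1_sum (Suc n) (\<lambda>x y. f x * g y + P x y)"

section \<open>Closure of product decompositions under sums, products and powers\<close>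

lemma rank1_sum_plus:
  assumes "rank1_sum n P" "rank1_sum k Q"
  shows "rank1_sum (n + k) (\<lambda>x y. P x y + Q x y)"
  using assms(1)
proof induction
  case zero
  then show ?case using assms(2) by simp
next
  case (add n P f g)
  then show ?case using rank1_sum.add[OF add.IH add.hyps(2,3)] by (simp add: add.assoc)
qed

lemma rank1_sum_scale:
  assumes "rank1_sum n P" "\<And>x. 0 \<le> a x \<and> a x \<le> 1" "\<And>y. 0 \<le> b y \<and> b y \<le> 1"
  shows "rank1_sum n (\<lambda>x y. a x * b y * P x y)"
  using assms(1)
proof induction
  case zero
  then show ?case using rank1_sum.zero by simp
next
  case (add n P f g)
  have "rank1_sum (Suc n) (\<lambda>x y. (a x * f x) * (b y * g y) + a x * b y * P x y)"
    using add assms by (intro rank1_sum.add) (auto intro!: mult_le_one)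
  then show ?case by (simp add: algebra_simps)
qed

lemma rank1_sum_times:
  assumes "rank1_sum n P" "rank1_sum k Q"
  shows "rank1_sum (n * k) (\<lambda>x y. P x y * Q x y)"
  using assms(1)
proof induction
  case zero
  then show ?case using rank1_sum.zero by simp
next
  case (add n P f g)
  have "rank1_sum (k + n * k) (\<lambda>x y. f x * g y * Q x y + P x y * Q x y)"
    by (intro rank1_sum_plus rank1_sum_scale add assms)
  then show ?case by (simp add: algebra_simps)
qed

lemma rank1_sum_const: "0 \<le> c \<Longrightarrow> c \<le> 1 \<Longrightarrow> rank1_sum 1 (\<lambda>x y. c)"
  using rank1_sum.add[OF rank1_sum.zero, of "\<lambda>_. c" "\<lambda>_. 1"] by simp

text \<open>Allows gap amplification: powers spread the values of \<open>P\<close> apart, while the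
  logarithm of the number of terms grows only by the factor \<open>t\<close>.\<close>

lemma rank1_sum_power:
  assumes "rank1_sum n P"
  shows "rank1_sum (n ^ t) (\<lambda>x y. P x y ^ t)"
  by (induction t) (use assms rank1_sum_const[of 1] in \<open>auto intro: rank1_sum_times\<close>)

lemma rank1_sum_mono:
  assumes "rank1_sum n P" "n \<le> k"
  shows "rank1_sum k P"
  using assms(2,1)
proof (induction rule: dec_induct)
  case (step k)
  then show ?case using rank1_sum.add[of k P "\<lambda>_. 0" "\<lambda>_. 0"] by simp
qed

lemma rank1_sum_sum:
  assumes "finite S" "\<And>s. s \<in> S \<Longrightarrow> rank1_sum n (P s)"
  shows "rank1_sum (card S * n) (\<lambda>x y. \<Sum>s\<in>S. P s x y)"
  using assms by (induction S) (auto intro: rank1_sum.zero rank1_sum_plus)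

text \<open>Both averages are linear in \<open>P\<close>, so the errors of the single products add
  up.\<close>

lemma corruption:
  assumes "rank1_sum n P" "m > 0"
  shows "avg_disj m P \<le> 12 * avg_inter m P + 20 * n * 2 powr (- (real m / 160))"
  using assms(1)
proof induction
  case zero
  then show ?case by (simp add: avg_disj_def avg_inter_def subset_avg_def)
next
  case (add n P f g)
  have "avg_disj m (\<lambda>X Y. f X * g Y + P X Y) = avg_disj m (\<lambda>X Y. f X * g Y) + avg_disj m P"
    by (simp add: avg_disj_def subset_avg_add)
  moreover have "avg_inter m (\<lambda>X Y. f X * g Y + P X Y) = avg_inter m (\<lambda>X Y. f X * g Y) + avg_inter m P"
    by (simp add: avg_inter_def subset_avg_add sum.distrib add_divide_distrib)
  moreover have "avg_disj m (\<lambda>X Y. f X * g Y)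
    \<le> 12 * avg_inter m (\<lambda>X Y. f X * g Y) + 20 * 2 powr (- (real m / 160))"
    using add.hyps assms(2) by (intro corruption_rank1) auto
  ultimately show ?case using add.IH by (simp add: algebra_simps)
qed

lemma avg_disj_ge:
  assumes "\<And>X Y. X \<subseteq> {..<m} \<Longrightarrow> Y \<subseteq> {..<m} \<Longrightarrow> X \<inter> Y = {} \<Longrightarrow> c \<le> P X Y"
  shows "c \<le> avg_disj m P"
  unfolding avg_disj_def
  by (intro subset_avg_ge_const assms) (auto intro: finite_subset[of _ "{..<m}"])

lemma avg_inter_le:
  assumes "m > 0"
    and "\<And>X Y. X \<subseteq> {..<m} \<Longrightarrow> Y \<subseteq> {..<m} \<Longrightarrow> X \<inter> Y \<noteq> {} \<Longrightarrow> P X Y \<le> c"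
  shows "avg_inter m P \<le> c"
proof -
  have "subset_avg ({..<m} - {i}) (\<lambda>Z. subset_avg Z (\<lambda>X.
     subset_avg ({..<m} - {i} - Z) (\<lambda>Y. P (insert i X) (insert i Y)))) \<le> c" if "i < m" for i
    using that by (intro subset_avg_le_const assms(2)) (auto intro: finite_subset[of _ "{..<m}"])
  then have "(\<Sum>i<m. subset_avg ({..<m} - {i}) (\<lambda>Z. subset_avg Z (\<lambda>X.
     subset_avg ({..<m} - {i} - Z) (\<lambda>Y. P (insert i X) (insert i Y))))) \<le> (\<Sum>i<m. c)"
    by (intro sum_mono) auto
  then show ?thesis using assms(1) by (simp add: avg_inter_def field_simps)
qed

section \<open>Acceptance probability of bounded runs\<close>

fun run_from :: "optm \<Rightarrow> symbol list \<Rightarrow> config \<Rightarrow> (nat \<Rightarrow> bool) \<Rightarrow> nat \<Rightarrow> config" where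
  "run_from M w C \<omega> 0 = C"
| "run_from M w C \<omega> (Suc t) = step M w (\<omega> t) (run_from M w C \<omega> t)"

lemma run_eq_run_from: "run M w \<omega> t = run_from M w (init_config M) \<omega> t"
  by (induction t) auto

lemma run_from_case_nat: "run_from M w C (case_nat b \<omega>) (Suc t) = run_from M w (step M w b C) \<omega> t"
  by (induction t) auto

lemma measurable_run_from [measurable]:
  "(\<lambda>\<omega>. run_from M w C \<omega> t) \<in> measurable coin_space (count_space UNIV)"
proof (induction t)
  case (Suc t)
  have coin [measurable]: "(\<lambda>\<omega>. \<omega> t) \<in> measurable coin_space (count_space UNIV)"
    unfolding coin_space_def
    by (rule measurable_compose[OF measurable_component_singleton]) auto
  have [measurable]: "(\<lambda>\<omega>. step M w b (run_from M w C \<omega> t)) \<in> measurable coin_space (count_space UNIV)" for b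
    by (rule measurable_compose[OF Suc]) simp
  have "(\<lambda>\<omega>. run_from M w C \<omega> (Suc t)) =
      (\<lambda>\<omega>. if \<omega> t then step M w True (run_from M w C \<omega> t) else step M w False (run_from M w C \<omega> t))"
    by auto
  also have "\<dots> \<in> measurable coin_space (count_space UNIV)"
    by measurable
  finally show ?case .
qed simp

text \<open>Prepending a fair coin to a random coin sequence reproduces the distribution
  \<open>coin_space\<close>; Fubini then leaves an average over the first coin.\<close>

lemma emeasure_coin_space_first:
  assumes "{\<omega> \<in> space coin_space. Q \<omega>} \<in> sets coin_space"
  shows "emeasure coin_space {\<omega> \<in> space coin_space. Q \<omega>} =
    (emeasure coin_space {\<omega> \<in> space coin_space. Q (case_nat True \<omega>)} +
     emeasure coin_space {\<omega> \<in> space coin_space. Q (case_nat False \<omega>)}) / 2"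
proof -
  let ?B = "measure_pmf (bernoulli_pmf (1/2))"
  interpret B: prob_space ?B by (rule prob_space_measure_pmf)
  interpret sequence_space ?B ..
  interpret C: prob_space coin_space by (rule prob_space_coin_space)
  have sp: "space coin_space = UNIV"
    by (simp add: coin_space_def space_PiM)
  let ?A = "{\<omega>. Q \<omega>}"
  have A: "?A \<in> sets coin_space" using assms sp by simp
  have iter: "distr (?B \<Otimes>\<^sub>M coin_space) coin_space (\<lambda>(s, \<omega>). case_nat s \<omega>) = coin_space"
    unfolding coin_space_def by (rule PiM_iter)
  have [measurable]: "(\<lambda>(s, \<omega>). case_nat s \<omega>) \<in> measurable (?B \<Otimes>\<^sub>M coin_space) coin_space"
    unfolding coin_space_def by measurable
  let ?F = "(\<lambda>(s, \<omega>). case_nat s \<omega>) -` ?A \<inter> space (?B \<Otimes>\<^sub>M coin_space)"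
  have "emeasure coin_space ?A = emeasure (distr (?B \<Otimes>\<^sub>M coin_space) coin_space (\<lambda>(s, \<omega>). case_nat s \<omega>)) ?A"
    by (simp only: iter)
  also have "\<dots> = emeasure (?B \<Otimes>\<^sub>M coin_space) ?F"
    using A by (intro emeasure_distr) measurable
  also have "\<dots> = (\<integral>\<^sup>+ s. emeasure coin_space (Pair s -` ?F) \<partial>?B)"
    using A by (intro C.emeasure_pair_measure_alt measurable_sets[of _ _ coin_space]) measurable
  also have "\<dots> = (\<integral>\<^sup>+ s. emeasure coin_space {\<omega>. Q (case_nat s \<omega>)} \<partial>?B)"
    by (intro nn_integral_cong arg_cong2[where f = emeasure])
      (auto simp: space_pair_measure sp)
  also have "\<dots> = (emeasure coin_space {\<omega>. Q (case_nat True \<omega>)} +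
     emeasure coin_space {\<omega>. Q (case_nat False \<omega>)}) / 2"
    by (subst nn_integral_measure_pmf_finite)
      (auto simp: UNIV_bool divide_ennreal_def algebra_simps ennreal_divide_numeral)
  finally show ?thesis by (simp add: sp)
qed

lemma measure_coin_space_first:
  assumes "{\<omega> \<in> space coin_space. Q \<omega>} \<in> sets coin_space"
  shows "measure coin_space {\<omega> \<in> space coin_space. Q \<omega>} =
    (measure coin_space {\<omega> \<in> space coin_space. Q (case_nat True \<omega>)} +
     measure coin_space {\<omega> \<in> space coin_space. Q (case_nat False \<omega>)}) / 2"
proof -
  interpret C: prob_space coin_space by (rule prob_space_coin_space)
  have "ennreal (measure coin_space {\<omega> \<in> space coin_space. Q \<omega>}) = ennreal
    ((measure coin_space {\<omega> \<in> space coin_space. Q (case_nat True \<omega>)} +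
     measure coin_space {\<omega> \<in> space coin_space. Q (case_nat False \<omega>)}) / 2)"
    using emeasure_coin_space_first[OF assms]
    by (simp add: C.emeasure_eq_measure ennreal_plus[symmetric] ennreal_divide_numeral del: ennreal_plus)
  then show ?thesis by simp
qed

text \<open>Peeling off the first coin replaces measures by finite averages, on which the later
  arguments can use induction; \<open>accept_within_eq_measure\<close> is the link to
  \<open>coin_space\<close>.\<close>

fun accept_within :: "optm \<Rightarrow> symbol list \<Rightarrow> nat \<Rightarrow> config \<Rightarrow> real" where
  "accept_within M w 0 C = of_bool (state C \<in> accepting M)"
| "accept_within M w (Suc t) C =
     (accept_within M w t (step M w True C) + accept_within M w t (step M w False C)) / 2"

lemma accept_within_eq_measure:
  "accept_within M w t C = measure coin_space {\<omega> \<in> space coin_space. state (run_from M w C \<omega> t) \<in> accepting M}"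
proof (induction t arbitrary: C)
  case 0
  interpret C: prob_space coin_space by (rule prob_space_coin_space)
  show ?case by (simp add: C.prob_space)
next
  case (Suc t)
  have "{\<omega> \<in> space coin_space. state (run_from M w C \<omega> (Suc t)) \<in> accepting M} \<in> sets coin_space"
    using measurable_sets[OF measurable_run_from, of "{D. state D \<in> accepting M}" M w C "Suc t"]
    by (simp add: vimage_def Int_def conj_commute del: run_from.simps)
  from measure_coin_space_first[OF this] show ?case
    unfolding run_from_case_nat by (simp add: Suc)
qed

lemma accept_within_bounds: "0 \<le> accept_within M w t C" "accept_within M w t C \<le> 1"
proof -
  have "0 \<le> accept_within M w t C \<and> accept_within M w t C \<le> 1"
  proof (induction t arbitrary: C)
    case (Suc t)
    show ?case
      using Suc[of "step M w True C"] Suc[of "step M w False C"] by simp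
  qed simp
  then show "0 \<le> accept_within M w t C" "accept_within M w t C \<le> 1" by auto
qed

lemma step_halting: "state C \<in> halting M \<Longrightarrow> step M w c C = C"
  by (simp add: step_def)

lemma accept_within_halting:
  "state C \<in> halting M \<Longrightarrow> accept_within M w t C = of_bool (state C \<in> accepting M)"
  by (induction t) (auto simp: step_halting)

lemma accept_within_Suc:
  assumes "is_optm M"
  shows "accept_within M w t C \<le> accept_within M w (Suc t) C"
proof (induction t arbitrary: C)
  case 0
  show ?case
  proof (cases "state C \<in> accepting M")
    case True
    then have "state C \<in> halting M" using assms by (auto simp: is_optm_def)
    then show ?thesis by (simp add: step_halting)
  qed (use accept_within_bounds(1)[of M w "Suc 0" C] in simp)
next
  case (Suc t)
  show ?case
    unfolding accept_within.simps(2)[of M w "Suc t" C] accept_within.simps(2)[of M w t C]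
    by (rule divide_right_mono[OF add_mono[OF Suc Suc]]) simp
qed

lemma accept_within_mono:
  "is_optm M \<Longrightarrow> t \<le> t' \<Longrightarrow> accept_within M w t C \<le> accept_within M w t' C"
  using lift_Suc_mono_le[of "\<lambda>t. accept_within M w t C"] accept_within_Suc by blast

text \<open>Accepting states halt, so the events of having accepted by time \<open>t\<close>
  increase, and continuity from below applies.\<close>

lemma accept_within_tendsto:
  assumes "is_optm M"
  shows "(\<lambda>t. accept_within M w t (init_config M)) \<longlonglongrightarrow> accept_prob M w"
proof -
  interpret C: prob_space coin_space by (rule prob_space_coin_space)
  let ?A = "\<lambda>t. {\<omega> \<in> space coin_space. state (run M w \<omega> t) \<in> accepting M}"
  have "incseq ?A"
  proof (rule incseq_SucI, safe)
    fix t \<omega> assume "state (run M w \<omega> t) \<in> accepting M"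
    moreover from this have "state (run M w \<omega> t) \<in> halting M" using assms by (auto simp: is_optm_def)
    ultimately show "state (run M w \<omega> (Suc t)) \<in> accepting M" by (simp add: step_halting)
  qed
  moreover have "range ?A \<subseteq> sets coin_space" using sets_run by auto
  ultimately have "(\<lambda>t. measure coin_space (?A t)) \<longlonglongrightarrow> measure coin_space (\<Union>t. ?A t)"
    by (intro C.finite_Lim_measure_incseq)
  also have "(\<Union>t. ?A t) = {\<omega> \<in> space coin_space. halts_accepting M w \<omega>}"
    by (auto simp: halts_accepting_def)
  finally show ?thesis
    by (simp add: accept_prob_def accept_within_eq_measure run_eq_run_from)
qed

lemma accept_within_le_accept_prob:
  assumes "is_optm M"
  shows "accept_within M w t (init_config M) \<le> accept_prob M w"
  by (rule incseq_le[OF _ accept_within_tendsto[OF assms]])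
    (auto intro!: incseq_SucI accept_within_Suc assms)

section \<open>Crossing a boundary of the input\<close>

text \<open>Halting configurations keep moving the input head to the right, so that every accepting
  computation crosses every boundary between two blocks of the input.\<close>

definition glide :: "optm \<Rightarrow> symbol list \<Rightarrow> bool \<Rightarrow> config \<Rightarrow> config" where
  "glide M w c C = (if state C \<in> halting M then C\<lparr>in_pos := Suc (in_pos C)\<rparr> else step M w c C)"

text \<open>Whether a halted configuration accepts does not depend on its input position, so
  \<open>glide\<close> may replace \<open>step\<close>.\<close>

lemma accept_within_glide:
  "accept_within M w (Suc t) C = (accept_within M w t (glide M w True C) + accept_within M w t (glide M w False C)) / 2"
  by (cases "state C \<in> halting M") (auto simp: glide_def accept_within_halting step_halting)

lemma in_pos_glide: "in_pos C \<le> in_pos (glide M w c C)" "in_pos (glide M w c C) \<le> Suc (in_pos C)"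
  by (auto simp: glide_def step_def split: prod.splits)

text \<open>A hitting probability: the gliding computation from \<open>C\<close> is stopped once its
  input head is at \<open>b\<close> or beyond, and \<open>C'\<close> is the configuration found
  there within \<open>t\<close> steps.\<close>

fun cross :: "optm \<Rightarrow> symbol list \<Rightarrow> nat \<Rightarrow> nat \<Rightarrow> config \<Rightarrow> config \<Rightarrow> real" where
  "cross M w b 0 C C' = of_bool (b \<le> in_pos C \<and> C = C')"
| "cross M w b (Suc t) C C' =
     (if b \<le> in_pos C then of_bool (C = C')
      else (cross M w b t (glide M w True C) C' + cross M w b t (glide M w False C) C') / 2)"

lemma cross_stopped: "b \<le> in_pos C \<Longrightarrow> cross M w b t C C' = of_bool (C = C')"
  by (cases t) auto

lemma cross_bounds: "0 \<le> cross M w b t C C'" "cross M w b t C C' \<le> 1"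
proof -
  have "0 \<le> cross M w b t C C' \<and> cross M w b t C C' \<le> 1"
  proof (induction t arbitrary: C)
    case (Suc t)
    show ?case
      using Suc[of "glide M w True C"] Suc[of "glide M w False C"] by simp
  qed simp
  then show "0 \<le> cross M w b t C C'" "cross M w b t C C' \<le> 1" by auto
qed

lemma glide_local:
  "input_cell w (in_pos C) = input_cell w' (in_pos C) \<Longrightarrow> glide M w c C = glide M w' c C"
  by (simp add: glide_def step_def)

text \<open>The one-way head reads only cells from its present position up to \<open>b\<close>
  before it is stopped.\<close>

lemma cross_local:
  assumes "\<And>i. in_pos C \<le> i \<Longrightarrow> i < b \<Longrightarrow> input_cell w i = input_cell w' i"
  shows "cross M w b t C C' = cross M w' b t C C'"
  using assms
proof (induction t arbitrary: C)
  case (Suc t)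
  show ?case
  proof (cases "b \<le> in_pos C")
    case False
    then have "glide M w c C = glide M w' c C" for c
      using Suc.prems by (intro glide_local) auto
    moreover have "cross M w b t (glide M w c C) C' = cross M w' b t (glide M w c C) C'" for c
      using in_pos_glide(1)[of C M w c] by (intro Suc) auto
    ultimately show ?thesis using False by simp
  qed simp
qed simp

lemma accept_within_local:
  assumes "\<And>i. in_pos C \<le> i \<Longrightarrow> input_cell w i = input_cell w' i"
  shows "accept_within M w t C = accept_within M w' t C"
  using assms
proof (induction t arbitrary: C)
  case (Suc t)
  have "glide M w c C = glide M w' c C" for c
    using Suc.prems by (intro glide_local) auto
  moreover have "accept_within M w t (glide M w c C) = accept_within M w' t (glide M w c C)" for c
    using in_pos_glide(1)[of C M w c] Suc.prems by (intro Suc) auto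
  ultimately show ?case
    unfolding accept_within_glide by simp
qed simp

lemma sum_cross_stopped:
  assumes "finite S" "b \<le> in_pos C"
  shows "(\<Sum>C'\<in>S. cross M w b t C C' * a C') = (if C \<in> S then a C else 0)"
proof -
  have "(\<Sum>C'\<in>S. cross M w b t C C' * a C') = (\<Sum>C'\<in>S. if C = C' then a C' else 0)"
    using assms(2) by (intro sum.cong) (auto simp: cross_stopped)
  then show ?thesis using assms(1) by simp
qed

text \<open>Stopping at the boundary and restarting from there decomposes accepting paths; paths
  that cross too late or outside \<open>S\<close> are lost, hence only an inequality.\<close>

lemma cross_accept_within_le:
  assumes M: "is_optm M" and S: "finite S"
  shows "(\<Sum>C'\<in>S. cross M w b t C C' * accept_within M w t' C') \<le> accept_within M w (t + t') C"
proof (induction t arbitrary: C)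
  case 0
  show ?case
  proof (cases "b \<le> in_pos C")
    case True
    then show ?thesis
      using sum_cross_stopped[OF S True, of M w 0] by (simp add: accept_within_bounds del: cross.simps)
  qed (simp add: accept_within_bounds)
next
  case (Suc t)
  show ?case
  proof (cases "b \<le> in_pos C")
    case True
    have "accept_within M w t' C \<le> accept_within M w (Suc t + t') C"
      by (intro accept_within_mono M) simp
    then show ?thesis
      unfolding sum_cross_stopped[OF S True] by (simp add: accept_within_bounds del: accept_within.simps)
  next
    case False
    have "(\<Sum>C'\<in>S. cross M w b (Suc t) C C' * accept_within M w t' C')
        = ((\<Sum>C'\<in>S. cross M w b t (glide M w True C) C' * accept_within M w t' C')
          + (\<Sum>C'\<in>S. cross M w b t (glide M w False C) C' * accept_within M w t' C')) / 2"
      using False by (simp add: sum.distrib[symmetric] sum_divide_distrib algebra_simps add_divide_distrib)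
    also have "\<dots> \<le> accept_within M w (Suc (t + t')) C"
      unfolding accept_within_glide using Suc[of "glide M w True C"] Suc[of "glide M w False C"] by simp
    finally show ?thesis by simp
  qed
qed

text \<open>The converse: nothing is lost if all crossings land in \<open>S\<close> and time
  suffices. A path accepting within \<open>t\<close> steps reaches \<open>b\<close> after at most
  \<open>t\<close> proper steps and \<open>b - in_pos C\<close> gliding steps.\<close>

lemma accept_within_le_cross:
  assumes M: "is_optm M" and S: "finite S"
    and R: "\<And>C c. C \<in> R \<Longrightarrow> glide M w c C \<in> R" and RS: "\<And>C. C \<in> R \<Longrightarrow> in_pos C = b \<Longrightarrow> C \<in> S"
  shows "C \<in> R \<Longrightarrow> in_pos C \<le> b \<Longrightarrow> t + (b - in_pos C) \<le> u \<Longrightarrow>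
    accept_within M w t C \<le> (\<Sum>C'\<in>S. cross M w b u C C' * accept_within M w t C')"
proof (induction u arbitrary: C t)
  case 0
  then have "in_pos C = b" by simp
  then show ?case using 0 RS sum_cross_stopped[OF S, of b C M w 0] by (simp del: cross.simps)
next
  case (Suc u)
  show ?case
  proof (cases "in_pos C = b")
    case True
    then show ?thesis
      using Suc.prems RS sum_cross_stopped[OF S, of b C M w "Suc u"] by (simp del: cross.simps)
  next
    case False
    then have lt: "in_pos C < b" using Suc.prems by simp
    have le: "in_pos (glide M w c C) \<le> b" for c
      using in_pos_glide(2)[of M w c C] lt by simp
    have split: "(\<Sum>C'\<in>S. cross M w b (Suc u) C C' * a C')
        = ((\<Sum>C'\<in>S. cross M w b u (glide M w True C) C' * a C')
          + (\<Sum>C'\<in>S. cross M w b u (glide M w False C) C' * a C')) / 2" for a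
      using lt by (simp add: sum.distrib[symmetric] sum_divide_distrib algebra_simps add_divide_distrib)
    consider "state C \<in> halting M" | "state C \<notin> halting M" "t = 0" | t' where "state C \<notin> halting M" "t = Suc t'"
      by (cases t) auto
    then show ?thesis
    proof cases
      case 1
      \<comment> \<open>A gliding step shortens the distance to \<open>b\<close>, so
        \<open>t\<close> stays the same in the induction hypothesis.\<close>
      have "accept_within M w t C = accept_within M w t (glide M w c C)" for c
        using 1 by (simp add: glide_def accept_within_halting)
      moreover have "accept_within M w t (glide M w c C)
          \<le> (\<Sum>C'\<in>S. cross M w b u (glide M w c C) C' * accept_within M w t C')" for c
        using 1 lt Suc.prems by (intro Suc.IH R le) (auto simp: glide_def)
      ultimately have "accept_within M w t C
          \<le> (\<Sum>C'\<in>S. cross M w b u (glide M w c C) C' * accept_within M w t C')" for c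
        by (metis (no_types, lifting))
      from this[of True] this[of False] show ?thesis
        unfolding split by simp
    next
      case 2
      then have "accept_within M w t C = 0"
        using M by (auto simp: is_optm_def)
      then show ?thesis
        by (simp add: sum_nonneg cross_bounds accept_within_bounds)
    next
      case (3 t')
      have "accept_within M w t' (glide M w c C)
          \<le> (\<Sum>C'\<in>S. cross M w b u (glide M w c C) C' * accept_within M w t C')" for c
      proof -
        \<comment> \<open>A proper step may leave the distance to \<open>b\<close> unchanged and is
          paid for by lowering \<open>t\<close> to \<open>t'\<close>.\<close>
        have "accept_within M w t' (glide M w c C)
          \<le> (\<Sum>C'\<in>S. cross M w b u (glide M w c C) C' * accept_within M w t' C')"
          using 3 Suc.prems in_pos_glide(1)[of C M w c] by (intro Suc.IH R le) auto
        also have "\<dots> \<le> (\<Sum>C'\<in>S. cross M w b u (glide M w c C) C' * accept_within M w t C')"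
          using 3 by (intro sum_mono mult_left_mono accept_within_mono M cross_bounds) auto
        finally show ?thesis .
      qed
      from this[of True] this[of False] show ?thesis
        unfolding split unfolding 3 accept_within_glide by simp
    qed
  qed
qed

section \<open>Decomposition at block boundaries\<close>

definition bounded_configs :: "optm \<Rightarrow> nat \<Rightarrow> nat \<Rightarrow> config set" where
  "bounded_configs M s b = {C. in_pos C = b \<and> state C \<in> states M \<and> \<bar>work_pos C\<bar> \<le> int s \<and>
     (\<forall>i. work_tape C i \<noteq> None \<longrightarrow> \<bar>i\<bar> \<le> int s)}"

lemma card_UNIV_symbol_option: "card (UNIV :: symbol option set) = 4" "finite (UNIV :: symbol option set)"
proof -
  have "x \<in> {None, Some Zero, Some One, Some Hash}" for x :: "symbol option"
    by (cases x; cases "the x") auto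
  then have U: "(UNIV :: symbol option set) = {None, Some Zero, Some One, Some Hash}"
    by blast
  show "card (UNIV :: symbol option set) = 4" "finite (UNIV :: symbol option set)"
    unfolding U by simp_all
qed

text \<open>State, head position and the tape on the window of \<open>2 * s + 1\<close> cells
  determine the configuration; the base 4 counts three symbols and the blank.\<close>

lemma bounded_configs_finite_card:
  assumes "finite (states M)"
  shows "finite (bounded_configs M s b)"
    and "card (bounded_configs M s b) \<le> card (states M) * (2 * s + 1) * 4 ^ (2 * s + 1)"
proof -
  define W where "W = {- int s..int s}"
  define cfg where "cfg = (\<lambda>(q, h, g). \<lparr>state = q, in_pos = b, work_pos = h,
    work_tape = (\<lambda>i. if i \<in> W then g i else None)\<rparr>)"
  define E where "E = states M \<times> W \<times> (W \<rightarrow>\<^sub>E (UNIV :: symbol option set))"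
  have sub: "bounded_configs M s b \<subseteq> cfg ` E"
  proof
    fix C assume C: "C \<in> bounded_configs M s b"
    then have "work_tape C i = None" if "i \<notin> W" for i
      using that by (auto simp: bounded_configs_def W_def abs_le_iff)
    then have "C = cfg (state C, work_pos C, restrict (work_tape C) W)"
      using C by (intro config.equality) (auto simp: cfg_def bounded_configs_def)
    moreover have "(state C, work_pos C, restrict (work_tape C) W) \<in> E"
      using C by (auto simp: E_def bounded_configs_def W_def)
    ultimately show "C \<in> cfg ` E" by blast
  qed
  have finE: "finite E"
    using assms card_UNIV_symbol_option by (auto simp: E_def W_def intro!: finite_PiE finite_cartesian_product)
  then show "finite (bounded_configs M s b)"
    using sub finite_subset by blast
  have "card (bounded_configs M s b) \<le> card E"
    using surj_card_le[OF finE sub] .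
  also have "card W = 2 * s + 1" by (simp add: W_def)
  then have "card E = card (states M) * (2 * s + 1) * 4 ^ (2 * s + 1)"
    by (simp add: E_def card_cartesian_product card_PiE W_def card_UNIV_symbol_option algebra_simps)
  finally show "card (bounded_configs M s b) \<le> card (states M) * (2 * s + 1) * 4 ^ (2 * s + 1)" .
qed

lemma run_cong: "(\<And>i. i < t \<Longrightarrow> \<omega> i = \<omega>' i) \<Longrightarrow> run M w \<omega> t = run M w \<omega>' t"
  by (induction t) auto

lemma state_run: "is_optm M \<Longrightarrow> state (run M w \<omega> t) \<in> states M"
proof (induction t)
  case (Suc t)
  then have "fst (delta M (state (run M w \<omega> t)) a b c) \<in> states M" for a b c
    by (auto simp: is_optm_def)
  then show ?case
    using Suc by (auto simp: step_def split: prod.splits) (metis fst_conv)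
qed (auto simp: is_optm_def init_config_def)

lemma work_pos_step: "\<bar>work_pos (step M w c C) - work_pos C\<bar> \<le> 1"
proof -
  have "\<bar>move_head mv p - p\<bar> \<le> 1" for mv p by (cases mv) auto
  then show ?thesis by (auto simp: step_def split: prod.splits)
qed

lemma work_tape_step: "work_tape (step M w c C) i \<noteq> work_tape C i \<Longrightarrow> i = work_pos C"
  by (auto simp: step_def split: prod.splits if_splits)

text \<open>The work head moves by at most one cell, so it cannot skip any; this turns the number of
  scanned cells into a bound on the distance from the origin.\<close>

lemma interval_visited:
  "{min 0 (work_pos (run M w \<omega> t))..max 0 (work_pos (run M w \<omega> t))}
    \<subseteq> (\<lambda>i. work_pos (run M w \<omega> i)) ` {..t}"
proof (induction t)
  case 0
  show ?case by (auto simp: init_config_def)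
next
  case (Suc t)
  let ?p = "work_pos (run M w \<omega> t)" and ?p' = "work_pos (run M w \<omega> (Suc t))"
  have "{min 0 ?p'..max 0 ?p'} \<subseteq> insert ?p' {min 0 ?p..max 0 ?p}"
    using work_pos_step[of M w "\<omega> t" "run M w \<omega> t"] by auto
  also have "\<dots> \<subseteq> insert ?p' ((\<lambda>i. work_pos (run M w \<omega> i)) ` {..t})"
    using Suc by blast
  also have "\<dots> = (\<lambda>i. work_pos (run M w \<omega> i)) ` {..Suc t}"
    by (simp add: atMost_Suc)
  finally show ?case .
qed

lemma work_tape_visited:
  "work_tape (run M w \<omega> t) i \<noteq> None \<Longrightarrow> i \<in> (\<lambda>i. work_pos (run M w \<omega> i)) ` {..t}"
proof (induction t)
  case (Suc t)
  then show ?case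
    using work_tape_step[of M w "\<omega> t" "run M w \<omega> t" i] by (fastforce simp: atMost_Suc)
qed (simp add: init_config_def)

lemma work_pos_le_space:
  assumes "space_used M w \<le> enat s"
  shows "\<bar>work_pos (run M w \<omega> t)\<bar> \<le> int s"
proof -
  let ?p = "work_pos (run M w \<omega> t)" and ?V = "(\<lambda>i. work_pos (run M w \<omega> i)) ` {..t}"
  have "card ?V \<le> s"
    using assms by (auto simp: space_used_def SUP_le_iff)
  moreover have "card {min 0 ?p..max 0 ?p} \<le> card ?V"
    by (rule card_mono[OF _ interval_visited]) simp
  ultimately show ?thesis by auto
qed

text \<open>Halted configurations may carry any input position, which makes the set closed under
  \<open>glide\<close>.\<close>

definition reachable :: "optm \<Rightarrow> symbol list \<Rightarrow> config set" where
  "reachable M w = {(run M w \<omega> t)\<lparr>in_pos := p\<rparr> | \<omega> t p.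
     state (run M w \<omega> t) \<notin> halting M \<longrightarrow> p = in_pos (run M w \<omega> t)}"

lemma reachable_init: "init_config M \<in> reachable M w"
  unfolding reachable_def by (rule CollectI, rule exI[of _ "\<lambda>_. False"], rule exI[of _ 0],
      rule exI[of _ "in_pos (init_config M)"]) auto

lemma reachable_glide:
  assumes "C \<in> reachable M w"
  shows "glide M w c C \<in> reachable M w"
proof -
  obtain \<omega> t p where C: "C = (run M w \<omega> t)\<lparr>in_pos := p\<rparr>"
    and p: "state (run M w \<omega> t) \<notin> halting M \<Longrightarrow> p = in_pos (run M w \<omega> t)"
    using assms by (auto simp: reachable_def)
  show ?thesis
  proof (cases "state C \<in> halting M")
    case True
    then have "glide M w c C = (run M w \<omega> t)\<lparr>in_pos := Suc p\<rparr>" "state (run M w \<omega> t) \<in> halting M"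
      by (auto simp: glide_def C)
    then show ?thesis unfolding reachable_def by blast
  next
    case False
    then have "C = run M w \<omega> t" using p C by simp
    moreover define \<omega>' where "\<omega>' = fun_upd \<omega> t c"
    moreover have "run M w \<omega>' t = run M w \<omega> t"
      by (rule run_cong) (simp add: \<omega>'_def)
    ultimately have "glide M w c C = run M w \<omega>' (Suc t)"
      using False by (simp add: glide_def)
    then have "glide M w c C = (run M w \<omega>' (Suc t))\<lparr>in_pos := in_pos (run M w \<omega>' (Suc t))\<rparr>"
      by (simp del: run.simps)
    then show ?thesis unfolding reachable_def by blast
  qed
qed

lemma reachable_bounded:
  assumes "is_optm M" "space_used M w \<le> enat s" "C \<in> reachable M w"
  shows "C \<in> bounded_configs M s (in_pos C)"
proof -
  obtain \<omega> t p where C: "C = (run M w \<omega> t)\<lparr>in_pos := p\<rparr>"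
    using assms by (auto simp: reachable_def)
  then show ?thesis
    using state_run[OF assms(1)] work_pos_le_space[OF assms(2)] work_tape_visited[of M w \<omega> t]
    by (fastforce simp: bounded_configs_def)
qed

text \<open>Acceptance summed over the configurations at all boundaries in \<open>bs\<close>. Each
  segment has its own time budget \<open>T\<close>, so the value is only sandwiched between
  acceptance probabilities of bounded runs, by \<open>split_prob_ge\<close> and
  \<open>split_prob_le\<close>.\<close>

fun split_prob :: "optm \<Rightarrow> symbol list \<Rightarrow> nat \<Rightarrow> nat \<Rightarrow> nat list \<Rightarrow> config \<Rightarrow> real" where
  "split_prob M w s T [] C = accept_within M w T C"
| "split_prob M w s T (b # bs) C =
     (\<Sum>C'\<in>bounded_configs M s b. cross M w b T C C' * split_prob M w s T bs C')"

lemma split_prob_nonneg: "0 \<le> split_prob M w s T bs C"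
  by (induction bs arbitrary: C) (auto intro!: sum_nonneg mult_nonneg_nonneg cross_bounds accept_within_bounds)

lemma split_prob_le:
  assumes M: "is_optm M"
  shows "split_prob M w s T bs C \<le> accept_within M w (T + T * length bs) C"
proof (induction bs arbitrary: C)
  case (Cons b bs)
  have "split_prob M w s T (b # bs) C
      \<le> (\<Sum>C'\<in>bounded_configs M s b. cross M w b T C C' * accept_within M w (T + T * length bs) C')"
    using Cons by (auto intro!: sum_mono mult_left_mono cross_bounds)
  also have "\<dots> \<le> accept_within M w (T + (T + T * length bs)) C"
    using M by (intro cross_accept_within_le bounded_configs_finite_card) (auto simp: is_optm_def)
  finally show ?case by (simp add: algebra_simps)
qed simp

lemma split_prob_ge:
  assumes M: "is_optm M" and sp: "space_used M w \<le> enat s"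
  shows "C \<in> reachable M w \<Longrightarrow> sorted (in_pos C # bs) \<Longrightarrow> t \<le> T \<Longrightarrow> (\<forall>b\<in>set bs. t + b \<le> T) \<Longrightarrow>
    accept_within M w t C \<le> split_prob M w s T bs C"
proof (induction bs arbitrary: C)
  case Nil
  then show ?case using accept_within_mono[OF M] by simp
next
  case (Cons b bs)
  let ?S = "bounded_configs M s b"
  have fin: "finite ?S" using M by (intro bounded_configs_finite_card) (auto simp: is_optm_def)
  \<comment> \<open>Only reachable crossings are kept, since the induction hypothesis speaks of
    these; the remaining summands are nonnegative and return at the end.\<close>
  have "accept_within M w t C
      \<le> (\<Sum>C'\<in>?S \<inter> reachable M w. cross M w b T C C' * accept_within M w t C')"
    using Cons.prems fin reachable_glide reachable_bounded[OF M sp]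
    by (intro accept_within_le_cross[OF M, of _ "reachable M w"]) auto
  also have "\<dots> \<le> (\<Sum>C'\<in>?S \<inter> reachable M w. cross M w b T C C' * split_prob M w s T bs C')"
    using Cons.prems by (intro sum_mono mult_left_mono Cons.IH cross_bounds) (auto simp: bounded_configs_def)
  also have "\<dots> \<le> split_prob M w s T (b # bs) C"
    using fin by (auto intro!: sum_mono2 mult_nonneg_nonneg cross_bounds split_prob_nonneg)
  finally show ?case .
qed

section \<open>Product decomposition along the blocks\<close>

fun block_ends :: "nat \<Rightarrow> nat list \<Rightarrow> nat list" where
  "block_ends p [] = []"
| "block_ends p (l # ls) = (p + l) # block_ends (p + l) ls"

lemma block_ends_ge: "b \<in> set (block_ends p ls) \<Longrightarrow> p \<le> b"
  by (induction ls arbitrary: p) fastforce+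

lemma sorted_block_ends: "sorted (p # block_ends p ls)"
  by (induction ls arbitrary: p) (auto dest: block_ends_ge)

definition one_sided :: "('a \<Rightarrow> 'a \<Rightarrow> symbol list) \<Rightarrow> bool" where
  "one_sided v \<longleftrightarrow> (\<exists>r. v = (\<lambda>X Y. r X)) \<or> (\<exists>r. v = (\<lambda>X Y. r Y))"

text \<open>Each boundary sums over at most \<open>N\<close> configurations, and the crossing factor
  of a one-sided block depends on \<open>X\<close> only or on \<open>Y\<close> only, so it rescales
  the factors of the remaining decomposition. The prefix \<open>u\<close> has already been
  read.\<close>

lemma rank1_sum_split_prob:
  fixes vs :: "('a \<Rightarrow> 'a \<Rightarrow> symbol list) list"
  assumes M: "finite (states M)" and N: "N = card (states M) * (2 * s + 1) * 4 ^ (2 * s + 1)"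
    and "list_all2 (\<lambda>v l. \<forall>X Y. length (v X Y) = l) vs ls"
    and "\<forall>v\<in>set vs. one_sided v" and "\<And>X Y. length (u X Y) = in_pos C"
  shows "rank1_sum (N ^ length vs)
    (\<lambda>X Y. split_prob M (u X Y @ concat (map (\<lambda>v. v X Y) vs)) s T (block_ends (in_pos C) ls) C)"
  using assms(3-)
proof (induction arbitrary: u C rule: list_all2_induct)
  case Nil
  \<comment> \<open>The head is past the end of the input and scans blanks only.\<close>
  have "accept_within M (u X Y) T C = accept_within M [] T C" for X Y
    using Nil by (intro accept_within_local) (auto simp: input_cell_def)
  then show ?case using rank1_sum_const[of "accept_within M [] T C"] by (simp add: accept_within_bounds)
next
  case (Cons v vs l ls)
  let ?b = "in_pos C + l"
  let ?W = "\<lambda>X Y. u X Y @ concat (map (\<lambda>v. v X Y) (v # vs))"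
  let ?S = "bounded_configs M s ?b"
  have "rank1_sum (N ^ length vs) (\<lambda>X Y. cross M (?W X Y) ?b T C C' *
      split_prob M (?W X Y) s T (block_ends ?b ls) C')" if C': "C' \<in> ?S" for C'
  proof -
    have pos: "in_pos C' = ?b" using C' by (simp add: bounded_configs_def)
    have "rank1_sum (N ^ length vs) (\<lambda>X Y. split_prob M ((u X Y @ v X Y) @ concat (map (\<lambda>v. v X Y) vs)) s T
        (block_ends (in_pos C') ls) C')"
      using Cons.prems Cons.hyps pos by (intro Cons.IH) auto
    then have IH: "rank1_sum (N ^ length vs) (\<lambda>X Y. split_prob M (?W X Y) s T (block_ends ?b ls) C')"
      by (simp add: pos)
    \<comment> \<open>Neither the prefix already read nor the suffix matters for the crossing, so a
      dummy prefix of the same length makes it a function of the block alone.\<close>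
    define q where "q z = cross M (replicate (in_pos C) Zero @ z) ?b T C C'" for z
    have q: "cross M (?W X Y) ?b T C C' = q (v X Y)" for X Y
      unfolding q_def using Cons.prems Cons.hyps
      by (intro cross_local) (auto simp: input_cell_def nth_append)
    have q01: "0 \<le> q z \<and> q z \<le> 1" for z
      by (simp add: q_def cross_bounds)
    from Cons.prems have "one_sided v" by simp
    then consider r where "v = (\<lambda>X Y. r X)" | r where "v = (\<lambda>X Y. r Y)"
      unfolding one_sided_def by blast
    then show ?thesis
    proof cases
      case (1 r)
      then show ?thesis
        unfolding q using rank1_sum_scale[OF IH, of "\<lambda>X. q (r X)" "\<lambda>_. 1"] q01 by simp
    next
      case (2 r)
      then show ?thesis
        unfolding q using rank1_sum_scale[OF IH, of "\<lambda>_. 1" "\<lambda>Y. q (r Y)"] q01 by simp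
    qed
  qed
  then have "rank1_sum (card ?S * N ^ length vs) (\<lambda>X Y. \<Sum>C'\<in>?S. cross M (?W X Y) ?b T C C' *
      split_prob M (?W X Y) s T (block_ends ?b ls) C')"
    by (intro rank1_sum_sum bounded_configs_finite_card M)
  moreover have "card ?S * N ^ length vs \<le> N ^ length (v # vs)"
    using bounded_configs_finite_card(2)[OF M, of s ?b] by (simp add: N)
  ultimately show ?case
    using rank1_sum_mono by fastforce
qed

section \<open>Words encoding pairs of sets\<close>

definition char_word :: "nat \<Rightarrow> nat set \<Rightarrow> symbol list" where
  "char_word m X = bits (map (\<lambda>i. i \<in> X) [0..<m])"

text \<open>Every separator is attached to the word before it, so no block mixes \<open>X\<close>
  and \<open>Y\<close>; the constant header is trivially one-sided.\<close>

definition disj_blocks :: "nat \<Rightarrow> (nat set \<Rightarrow> nat set \<Rightarrow> symbol list) list" where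
  "disj_blocks k = (\<lambda>X Y. replicate k One @ [Hash]) # concat (replicate (2 ^ k)
     [\<lambda>X Y. char_word (2 ^ (2 * k)) X @ [Hash],
      \<lambda>X Y. char_word (2 ^ (2 * k)) Y @ [Hash],
      \<lambda>X Y. char_word (2 ^ (2 * k)) X @ [Hash]])"

definition disj_word :: "nat \<Rightarrow> nat set \<Rightarrow> nat set \<Rightarrow> symbol list" where
  "disj_word k X Y = concat (map (\<lambda>v. v X Y) (disj_blocks k))"

lemma length_char_word: "length (char_word m X) = m"
  by (simp add: char_word_def bits_def)

lemma concat_map_concat_replicate:
  "concat (map f (concat (replicate n vs))) = concat (replicate n (concat (map f vs)))"
  by (induction n) auto

lemma length_concat_replicate: "length (concat (replicate n xs)) = n * length xs"
  by (induction n) auto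

lemma disj_word_eq:
  "disj_word k X Y = replicate k One @ [Hash] @ concat (replicate (2 ^ k)
     (char_word (2 ^ (2 * k)) X @ [Hash] @ char_word (2 ^ (2 * k)) Y @ [Hash] @ char_word (2 ^ (2 * k)) X @ [Hash]))"
  by (simp add: disj_word_def disj_blocks_def concat_map_concat_replicate)

lemma length_disj_blocks: "length (disj_blocks k) = 1 + 2 ^ k * 3"
  by (simp add: disj_blocks_def length_concat_replicate)

lemma set_concat_replicate: "set (concat (replicate n xs)) \<subseteq> set xs"
  by (induction n) auto

lemma disj_blocks_one_sided: "\<forall>v\<in>set (disj_blocks k). one_sided v"
  using set_concat_replicate[of "2 ^ k"
     "[\<lambda>X Y. char_word (2 ^ (2 * k)) X @ [Hash],
      \<lambda>X Y. char_word (2 ^ (2 * k)) Y @ [Hash],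
      \<lambda>X Y. char_word (2 ^ (2 * k)) X @ [Hash]]"]
  by (fastforce simp: disj_blocks_def one_sided_def)

lemma disj_blocks_lengths:
  "list_all2 (\<lambda>v l. \<forall>X Y. length (v X Y) = l) (disj_blocks k) (map (\<lambda>v. length (v {} {})) (disj_blocks k))"
  using set_concat_replicate[of "2 ^ k"
     "[\<lambda>X Y. char_word (2 ^ (2 * k)) X @ [Hash],
      \<lambda>X Y. char_word (2 ^ (2 * k)) Y @ [Hash],
      \<lambda>X Y. char_word (2 ^ (2 * k)) X @ [Hash]]"]
  by (fastforce simp: disj_blocks_def list.rel_map list_all2_same length_char_word)

lemma length_disj_word: "length (disj_word k X Y) = k + 1 + 2 ^ k * (3 * 2 ^ (2 * k) + 3)"
  by (simp add: disj_word_eq length_concat_replicate length_char_word algebra_simps)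

lemma replicate_Hash_inject:
  "replicate k One @ [Hash] @ xs = replicate k' One @ [Hash] @ ys \<Longrightarrow> k = k' \<and> xs = ys"
proof (induction k arbitrary: k')
  case 0
  then show ?case by (cases k') auto
next
  case (Suc k)
  then show ?case by (cases k') auto
qed

lemma bits_inject: "bits x = bits y \<Longrightarrow> x = y"
  unfolding bits_def by (rule list.inj_map_strong) (auto split: if_splits)

text \<open>The header determines \<open>k\<close>, and with it all lengths, so the strings can be
  read off from the first repetition.\<close>

lemma disj_word_in_L_DISJ:
  assumes "k \<ge> 1" "X \<subseteq> {..<2 ^ (2 * k)}"
  shows "disj_word k X Y \<in> L_DISJ \<longleftrightarrow> X \<inter> Y = {}"
proof
  let ?m = "2 ^ (2 * k) :: nat"
  let ?x = "map (\<lambda>i. i \<in> X) [0..<?m]" and ?y = "map (\<lambda>i. i \<in> Y) [0..<?m]"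
  {
    assume "disj_word k X Y \<in> L_DISJ"
    then obtain k' x y where xy: "length x = 2 ^ (2 * k')" "length y = 2 ^ (2 * k')" "DISJ (2 ^ (2 * k')) x y"
      and eq: "disj_word k X Y = replicate k' One @ [Hash] @
        concat (replicate (2 ^ k') (bits x @ [Hash] @ bits y @ [Hash] @ bits x @ [Hash]))"
      by (auto simp: L_DISJ_def)
    have k: "k = k'" and cc: "concat (replicate (2 ^ k) (bits ?x @ [Hash] @ bits ?y @ [Hash] @ bits ?x @ [Hash]))
      = concat (replicate (2 ^ k') (bits x @ [Hash] @ bits y @ [Hash] @ bits x @ [Hash]))"
      using replicate_Hash_inject[OF eq[unfolded disj_word_eq char_word_def]] by blast+
    \<comment> \<open>There is at least one repetition, which can be split off.\<close>
    obtain n where n: "(2::nat) ^ k = Suc n" by (cases "(2::nat) ^ k") auto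
    have "bits ?x = bits x \<and> bits ?y = bits y"
      using cc xy unfolding k[symmetric] n by (simp add: bits_def)
    then have "?x = x" "?y = y" using bits_inject by blast+
    with xy k have D: "DISJ ?m ?x ?y" by simp
    show "X \<inter> Y = {}"
    proof (rule ccontr)
      assume "X \<inter> Y \<noteq> {}"
      then obtain i where "i \<in> X" "i \<in> Y" by blast
      moreover from this have "i < ?m" using assms by auto
      ultimately show False using D by (auto simp: DISJ_def)
    qed
  }
  assume "X \<inter> Y = {}"
  then have "DISJ ?m ?x ?y" by (auto simp: DISJ_def)
  then show "disj_word k X Y \<in> L_DISJ"
    unfolding L_DISJ_def disj_word_eq char_word_def using assms by force
qed

section \<open>The lower bound\<close>

text \<open>The eighth power amplifies the gap between \<open>1/2\<close> and \<open>1/3\<close> beyond the loss of a factor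
  12 in \<open>corruption\<close>.\<close>

lemma disj_rank_lower_bound:
  fixes P :: "nat set \<Rightarrow> nat set \<Rightarrow> real"
  assumes P: "rank1_sum n P" and m: "m > 0" and nn: "\<And>X Y. 0 \<le> P X Y"
    and ge: "\<And>X Y. X \<subseteq> {..<m} \<Longrightarrow> Y \<subseteq> {..<m} \<Longrightarrow> X \<inter> Y = {} \<Longrightarrow> 1/2 \<le> P X Y"
    and le: "\<And>X Y. X \<subseteq> {..<m} \<Longrightarrow> Y \<subseteq> {..<m} \<Longrightarrow> X \<inter> Y \<noteq> {} \<Longrightarrow> P X Y \<le> 1/3"
  shows "2 powr (m / 160 - 14) \<le> real n ^ 8"
proof -
  let ?Q = "\<lambda>X Y. P X Y ^ 8"
  have "(1/2) ^ 8 \<le> avg_disj m ?Q"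
    using ge by (intro avg_disj_ge power_mono) auto
  also have "\<dots> \<le> 12 * avg_inter m ?Q + 20 * real (n ^ 8) * 2 powr (- (real m / 160))"
    by (rule corruption[OF rank1_sum_power[OF P] m])
  also have "avg_inter m ?Q \<le> (1/3) ^ 8"
    using le nn by (intro avg_inter_le m power_mono) auto
  \<comment> \<open>\<open>1 / 16384\<close> is the largest power of two below
    \<open>((1/2) ^ 8 - 12 * (1/3) ^ 8) / 20\<close>.\<close>
  finally have "1 / 16384 \<le> real n ^ 8 * 2 powr (- (real m / 160))"
    by (simp add: power_divide)
  moreover have "2 powr (- (real m / 160)) = 2 powr (-14) / 2 powr (m / 160 - 14)"
    by (simp add: powr_diff[symmetric])
  moreover have "2 powr (-14) = (1 / 16384 :: real)"
    by (simp add: powr_minus powr_numeral divide_simps)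
  ultimately show ?thesis by (simp add: field_simps)
qed

text \<open>The split acceptance probability has few product terms, yet stays at least 1/2 on
  disjoint pairs and below 1/3 on intersecting ones.\<close>

lemma online_space_lower_bound:
  assumes M: "is_optm M" and k: "k \<ge> 1"
    and acc: "\<And>w. w \<in> L_DISJ \<Longrightarrow> accept_prob M w \<ge> 2/3" and rej: "\<And>w. w \<notin> L_DISJ \<Longrightarrow> accept_prob M w < 1/3"
    and sp: "\<And>X Y. space_used M (disj_word k X Y) \<le> enat s"
  shows "2 powr (real (2 ^ (2 * k)) / 160 - 14)
    \<le> real ((card (states M) * (2 * s + 1) * 4 ^ (2 * s + 1)) ^ (1 + 2 ^ k * 3)) ^ 8"
proof -
  let ?U = "{..<2 ^ (2 * k)} :: nat set"
  \<comment> \<open>There are finitely many disjoint pairs, so a single time \<open>t\<close> brings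
    all of them to acceptance at least 1/2.\<close>
  define A where "A = {(X, Y). X \<subseteq> ?U \<and> Y \<subseteq> ?U \<and> X \<inter> Y = {}}"
  have "A \<subseteq> Pow ?U \<times> Pow ?U" by (auto simp: A_def)
  then have "finite A" by (rule finite_subset) auto
  moreover have "\<forall>\<^sub>F t in sequentially. 1/2 \<le> accept_within M (disj_word k (fst a) (snd a)) t (init_config M)"
    if "a \<in> A" for a
  proof -
    have "2/3 \<le> accept_prob M (disj_word k (fst a) (snd a))"
      using that k by (intro acc) (auto simp: A_def disj_word_in_L_DISJ)
    then have "\<forall>\<^sub>F t in sequentially. 1/2 < accept_within M (disj_word k (fst a) (snd a)) t (init_config M)"
      by (intro order_tendstoD(1)[OF accept_within_tendsto[OF M]]) auto
    then show ?thesis by eventually_elim simp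
  qed
  ultimately have "\<forall>\<^sub>F t in sequentially. \<forall>a\<in>A. 1/2 \<le> accept_within M (disj_word k (fst a) (snd a)) t (init_config M)"
    by (intro eventually_ball_finite) auto
  then obtain t where t: "\<And>a. a \<in> A \<Longrightarrow> 1/2 \<le> accept_within M (disj_word k (fst a) (snd a)) t (init_config M)"
    unfolding eventually_sequentially by blast
  define bs where "bs = block_ends 0 (map (\<lambda>v. length (v {} {})) (disj_blocks k))"
  \<comment> \<open>The sum dominates every single boundary, as \<open>split_prob_ge\<close>
    requires.\<close>
  define T where "T = t + sum_list bs"
  define P where "P X Y = split_prob M (disj_word k X Y) s T bs (init_config M)" for X Y
  have pos: "in_pos (init_config M) = 0" by (simp add: init_config_def)
  have fin: "finite (states M)" using M by (simp add: is_optm_def)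
  show ?thesis
  proof (rule disj_rank_lower_bound[of _ P])
    show "rank1_sum ((card (states M) * (2 * s + 1) * 4 ^ (2 * s + 1)) ^ (1 + 2 ^ k * 3)) P"
      using rank1_sum_split_prob[OF fin refl disj_blocks_lengths[of k] disj_blocks_one_sided,
          of "\<lambda>_ _. []" "init_config M" s T] pos
      by (simp add: P_def[abs_def] bs_def disj_word_def length_disj_blocks)
    show "0 \<le> P X Y" for X Y by (simp add: P_def split_prob_nonneg)
    show "(0::nat) < 2 ^ (2 * k)" by simp
  next
    fix X Y assume "X \<subseteq> ?U" "Y \<subseteq> ?U" "X \<inter> Y = {}"
    then have "1/2 \<le> accept_within M (disj_word k X Y) t (init_config M)"
      using t[of "(X, Y)"] by (simp add: A_def)
    also have "\<dots> \<le> P X Y"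
      unfolding P_def using sorted_block_ends[of 0] member_le_sum_list[of _ bs]
      by (intro split_prob_ge[OF M sp reachable_init]) (auto simp: pos bs_def T_def)
    finally show "1/2 \<le> P X Y" .
  next
    fix X Y assume "X \<subseteq> ?U" "Y \<subseteq> ?U" "X \<inter> Y \<noteq> {}"
    then have "accept_prob M (disj_word k X Y) < 1/3"
      using k by (intro rej) (simp add: disj_word_in_L_DISJ)
    moreover have "P X Y \<le> accept_prob M (disj_word k X Y)"
      unfolding P_def by (rule order_trans[OF split_prob_le[OF M] accept_within_le_accept_prob[OF M]])
    ultimately show "P X Y \<le> 1/3" by simp
  qed
qed

lemma card_configs_le: "q * (2 * s + 1) * 4 ^ (2 * s + 1) \<le> (2::nat) ^ (q + 6 * s + 3)"
proof -
  have "(4::nat) ^ (2 * s + 1) = 2 ^ (4 * s + 2)"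
    using power_mult[of "2::nat" 2 "2 * s + 1"] by (simp add: algebra_simps)
  moreover have "q * (2 * s + 1) \<le> 2 ^ q * 2 ^ (2 * s + 1)"
    by (intro mult_mono less_imp_le less_exp) auto
  ultimately have "q * (2 * s + 1) * 4 ^ (2 * s + 1) \<le> 2 ^ q * 2 ^ (2 * s + 1) * 2 ^ (4 * s + 2)"
    by (simp only: mult_right_mono)
  also have "\<dots> = (2::nat) ^ (q + 6 * s + 3)"
    by (simp add: power_add[symmetric] algebra_simps del: power_Suc)
  finally show ?thesis .
qed

text \<open>The length is at most seven times \<open>(2 ^ k) ^ 3\<close>; rounding 7 up to 8 makes
  the cube root exact.\<close>

lemma length_disj_word_powr: "real (length (disj_word k X Y)) powr (1/3) \<le> 2 * 2 ^ k"
proof -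
  have "k + 1 \<le> 2 ^ k" using less_exp[of k] by linarith
  moreover have "(2::nat) ^ k \<le> (2 ^ k) ^ 3" by (rule self_le_power) auto
  moreover have "(2::nat) ^ k * 2 ^ (2 * k) = (2 ^ k) ^ 3"
    by (simp add: power_mult[symmetric] power_add[symmetric] mult.commute)
  ultimately have "length (disj_word k X Y) \<le> 8 * (2 ^ k) ^ 3"
    unfolding length_disj_word by (simp add: algebra_simps)
  then have "real (length (disj_word k X Y)) \<le> real (8 * (2 ^ k) ^ 3)"
    by (rule of_nat_mono)
  then have "real (length (disj_word k X Y)) powr (1/3) \<le> ((2 * 2 ^ k) ^ 3) powr (1/3)"
    by (intro powr_mono2) (auto simp: power_mult_distrib)
  also have "\<dots> = 2 * 2 ^ k"
    using powr_powr[of "2 * 2 ^ k :: real" 3 "1/3"] by (simp add: powr_numeral)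
  finally show ?thesis .
qed

theorem theorem3p6:
  shows "\<exists>c1::real. c1 > 0 \<and> L_DISJ \<notin> OBPSPACE (\<lambda>n. c1 * real n powr (1/3))"
proof (intro exI conjI notI)
  \<comment> \<open>The constant satisfies \<open>12 * ?c * 32 + 1 / 1000 < 1 / 160\<close>, which
    decides the final comparison of the coefficients of \<open>K * K\<close>.\<close>
  let ?c = "1 / 200000 :: real"
  show "0 < ?c" by simp
  assume "L_DISJ \<in> OBPSPACE (\<lambda>n. ?c * real n powr (1/3))"
  then obtain M where M: "is_optm M"
    and acc: "\<And>w. w \<in> L_DISJ \<Longrightarrow> accept_prob M w \<ge> 2/3" and rej: "\<And>w. w \<notin> L_DISJ \<Longrightarrow> accept_prob M w < 1/3"
    and sp: "\<And>w. space_used M w \<le> enat (space_bound (?c * real (length w) powr (1/3)))"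
    unfolding OBPSPACE_def by blast
  define q where "q = card (states M)"
  \<comment> \<open>\<open>k\<close> is taken so large that the terms linear in \<open>K\<close>,
    which involve the fixed number of states, stay below \<open>K * K / 1000\<close>.\<close>
  obtain k where "nat \<lceil>32000 * (real q + 10)\<rceil> \<le> k" by blast
  then have qk: "32000 * (real q + 10) \<le> real k" by linarith
  define K where "K = (2::real) ^ k"
  have k1: "k \<ge> 1" using qk by (cases k) auto
  have K: "K \<ge> 32000 * (real q + 10)"
    using qk of_nat_less_two_power[of k, where 'a = real] unfolding K_def by linarith
  \<comment> \<open>The length of \<open>disj_word k X Y\<close> depends on \<open>k\<close> only,
    so the empty sets can stand for all pairs.\<close>
  define s where "s = space_bound (?c * real (length (disj_word k {} {})) powr (1/3))"
  have s: "real s \<le> 2 * ?c * K + 1"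
  proof -
    define r where "r = ?c * real (length (disj_word k {} {})) powr (1/3)"
    have "0 \<le> r" by (simp add: r_def)
    then have "real (space_bound r) \<le> r + 1"
      unfolding space_bound_def by linarith
    moreover have "r \<le> 2 * ?c * K"
      using length_disj_word_powr[of k "{}" "{}"] by (simp add: K_def r_def)
    ultimately show ?thesis unfolding s_def r_def by linarith
  qed
  have sp': "space_used M (disj_word k X Y) \<le> enat s" for X Y
    using sp[of "disj_word k X Y"] by (simp only: s_def length_disj_word)
  let ?m = "2 ^ (2 * k) :: nat"
  define e where "e = (q + 6 * s + 3) * (1 + 2 ^ k * 3) * 8"
  have "2 powr (real ?m / 160 - 14) \<le> real ((q * (2 * s + 1) * 4 ^ (2 * s + 1)) ^ (1 + 2 ^ k * 3)) ^ 8"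
    unfolding q_def by (rule online_space_lower_bound[OF M k1 acc rej sp'])
  also have "\<dots> \<le> real ((2 ^ (q + 6 * s + 3)) ^ (1 + 2 ^ k * 3)) ^ 8"
    by (intro power_mono of_nat_mono card_configs_le of_nat_0_le_iff zero_le)
  also have "\<dots> = 2 ^ e"
    unfolding e_def of_nat_power of_nat_numeral power_mult ..
  also have "\<dots> = 2 powr real e"
    by (simp add: powr_realpow)
  finally have "real ?m / 160 - 14 \<le> real e"
    by simp
  moreover have "real ?m = K * K"
    by (simp add: K_def power_add[symmetric] mult_2)
  moreover have "real e \<le> (real q + 12 * ?c * K + 9) * (32 * K)"
  proof -
    have "real e = (real q + 6 * real s + 3) * ((1 + K * 3) * 8)"
      by (simp add: K_def e_def algebra_simps)
    \<comment> \<open>The bound on \<open>s\<close> gives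
      \<open>6 * s + 3 \<le> 12 * ?c * K + 9\<close>, and \<open>K \<ge> 1\<close> gives
      \<open>(1 + K * 3) * 8 \<le> 32 * K\<close>.\<close>
    also have "\<dots> \<le> (real q + 12 * ?c * K + 9) * (32 * K)"
      by (rule mult_mono) (use s K in auto)
    finally show ?thesis .
  qed
  moreover have "(real q + 10) * 32 * K \<le> K / 1000 * K"
    using K by (intro mult_right_mono) auto
  moreover have "14 \<le> 32 * K" using K by simp
  moreover have "0 < K * K" using K by simp
  ultimately show False by (simp add: algebra_simps)
qed

end
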